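(* Let $G$ be a discrete group, let $E$ be a weak*-closed $G$-invariant subspace of $B(G)$, and let $q:C^*(G)\to C^*_E(G)$ be the quotient map. Then the following are equivalent: (1) $C^*_E(G)$ is a group $C^*$-algebra of $G$; (2) there is a bounded linear functional $\omega$ on $C^*_E(G)$ such that $\omega(q(x))=1$ if $x=e$ and $\omega(q(x))=0$ if $x\in G$, $x\neq e$; (3) $E$ contains the canonical trace $\mathrm{tr}$ on $C^*(G)$; (4) $E\supset B_r(G)$; (5) there is a (unique) homomorphism $\rho:C^*_E(G)\to C^*_r(G)$ such that $\rho\circ q=\lambda$.
   Context: $B(G)$ is the Fourier-Stieltjes algebra of $G$, identified with the dual space $C^*(G)^*$, with the corresponding weak*-topology. $E\subset B(G)$ is $G$-invariant if it is invariant under $(x\cdot f)(y)=f(yx)$ and $(f\cdot x)(y)=f(xy)$ for all $x\in G$. ${}^\perp E\subset C^*(G)$ is the preannihilator of $E$ (a closed two-sided ideal under these hypotheses), and $C^*_E(G):=C^*(G)/{}^\perp E$. $\lambda:C^*(G)\to C^*_r(G)$ is the regular representation, and $B_r(G)=(\ker\lambda)^\perp\subset B(G)$. $A(G)$ is the Fourier algebra. $C^*_E(G)$ is called a group $C^*$-algebra of $G$ if the following equivalent conditions hold: ${}^\perp E\subset\ker\lambda$; $E\supset B_r(G)$; $E\supset A(G)$; $E\supset C_c(G)\cap B(G)$. The canonical trace $\mathrm{tr}\in C^*(G)^*=B(G)$ is the functional corresponding to the characteristic function $\chi_{\{e\}}$ of the identity. $G$ is identified with its canonical image in $C^*(G)$.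 *)

theory Defs
  imports "HOL-Analysis.Analysis" "HOL-Library.Poly_Mapping" "HOL-Library.FuncSet"
begin

section \<open>Complex normed vector spaces\<close>

class scaleC =
  fixes scaleC :: "complex \<Rightarrow> 'a \<Rightarrow> 'a"  (infixr "*\<^sub>C" 75)

class complex_normed_vector = real_normed_vector + scaleC +
  assumes scaleC_add_right: "c *\<^sub>C (x + y) = c *\<^sub>C x + c *\<^sub>C y"
    and scaleC_add_left: "(c + d) *\<^sub>C x = c *\<^sub>C x + d *\<^sub>C x"
    and scaleC_scaleC: "c *\<^sub>C d *\<^sub>C x = (c * d) *\<^sub>C x"
    and scaleR_scaleC: "r *\<^sub>R x = complex_of_real r *\<^sub>C x"
    and norm_scaleC: "norm (c *\<^sub>C x) = cmod c * norm x"

lemma scaleC_one [simp]: "1 *\<^sub>C x = (x :: 'a :: complex_normed_vector)"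
  using scaleR_scaleC[of 1 x] by simp

lemma scaleC_zero_left [simp]: "0 *\<^sub>C x = (0 :: 'a :: complex_normed_vector)"
  using scaleR_scaleC[of 0 x] by simp

lemma scaleC_zero_right [simp]: "c *\<^sub>C 0 = (0 :: 'a :: complex_normed_vector)"
  using scaleC_add_right[of c 0 "0 :: 'a"] by simp

lemma scaleC_sum_right: "c *\<^sub>C sum f A = (\<Sum>x\<in>A. c *\<^sub>C (f x :: 'a :: complex_normed_vector))"
  by (induction A rule: infinite_finite_induct) (auto simp: scaleC_add_right)

section \<open>The Hilbert space of square-summable families\<close>

typedef 'a ell2 = "{f :: 'a \<Rightarrow> complex. (\<lambda>x. (cmod (f x))\<^sup>2) summable_on UNIV}"
  morphisms ell2_fun Abs_ell2
  by (rule exI[of _ "\<lambda>_. 0"]) simp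

setup_lifting type_definition_ell2

lift_definition ell2_norm :: "'a ell2 \<Rightarrow> real"
  is "\<lambda>f. sqrt (\<Sum>\<^sub>\<infinity>x. (cmod (f x))\<^sup>2)" .

lemma ell2_normI:
  assumes "\<And>F. finite F \<Longrightarrow> L2_set (\<lambda>x. cmod (f x)) F \<le> B"
  shows "(\<lambda>x. (cmod (f x))\<^sup>2) summable_on UNIV"
    and "sqrt (\<Sum>\<^sub>\<infinity>x. (cmod (f x))\<^sup>2) \<le> B"
proof -
  have B: "B \<ge> 0" using assms[of "{}"] by simp
  have le: "(\<Sum>x\<in>F. (cmod (f x))\<^sup>2) \<le> B\<^sup>2" if "finite F" for F
    using assms[OF that] unfolding L2_set_def by (rule sqrt_le_D)
  show s: "(\<lambda>x. (cmod (f x))\<^sup>2) summable_on UNIV"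
    by (rule nonneg_bdd_above_summable_on) (auto intro!: bdd_aboveI[of _ "B\<^sup>2"] le)
  show "sqrt (\<Sum>\<^sub>\<infinity>x. (cmod (f x))\<^sup>2) \<le> B"
    by (intro real_le_lsqrt B infsum_le_finite_sums[OF s] le)
qed

lemma L2_set_le_ell2_norm: "L2_set (\<lambda>x. cmod (ell2_fun v x)) F \<le> ell2_norm v"
proof (cases "finite F")
  case True
  have "(\<Sum>x\<in>F. (cmod (ell2_fun v x))\<^sup>2) \<le> (\<Sum>\<^sub>\<infinity>x. (cmod (ell2_fun v x))\<^sup>2)"
    using ell2_fun[of v] True by (intro finite_sum_le_infsum) auto
  then show ?thesis by (simp add: L2_set_def ell2_norm.rep_eq)
next
  case False
  then show ?thesis by (simp add: ell2_norm.rep_eq infsum_nonneg)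
qed

lemma ell2_norm_le:
  assumes "\<And>F. finite F \<Longrightarrow> L2_set (\<lambda>x. cmod (ell2_fun v x)) F \<le> B"
  shows "ell2_norm v \<le> B"
  using ell2_normI(2)[OF assms] by (simp add: ell2_norm.rep_eq)

lemma L2_set_cmod_add_le:
  "L2_set (\<lambda>x. cmod (f x + g x)) F \<le> L2_set (\<lambda>x. cmod (f x)) F + L2_set (\<lambda>x. cmod (g x)) F"
  by (rule order_trans[OF L2_set_mono L2_set_triangle_ineq]) (auto intro: norm_triangle_ineq)

lemma L2_set_cmod_scale: "L2_set (\<lambda>x. cmod (c * f x)) F = cmod c * L2_set (\<lambda>x. cmod (f x)) F"
  by (simp add: norm_mult L2_set_right_distrib)

instantiation ell2 :: (type) "{real_normed_vector, scaleC}"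
begin

lift_definition zero_ell2 :: "'a ell2" is "\<lambda>_. 0" by simp

lift_definition scaleC_ell2 :: "complex \<Rightarrow> 'a ell2 \<Rightarrow> 'a ell2" is "\<lambda>c f x. c * f x"
  by (auto simp: norm_mult power_mult_distrib intro: summable_on_cmult_right)

lift_definition plus_ell2 :: "'a ell2 \<Rightarrow> 'a ell2 \<Rightarrow> 'a ell2" is "\<lambda>f g x. f x + g x"
proof -
  fix f g :: "'a \<Rightarrow> complex"
  assume "(\<lambda>x. (cmod (f x))\<^sup>2) summable_on UNIV"
    and "(\<lambda>x. (cmod (g x))\<^sup>2) summable_on UNIV"
  then obtain v w where "f = ell2_fun v" "g = ell2_fun w"
    by (metis Abs_ell2_inverse mem_Collect_eq)
  then show "(\<lambda>x. (cmod (f x + g x))\<^sup>2) summable_on UNIV"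
    by (auto intro!: ell2_normI(1)[of _ "ell2_norm v + ell2_norm w"]
        order_trans[OF L2_set_cmod_add_le] add_mono L2_set_le_ell2_norm)
qed

definition scaleR_ell2 :: "real \<Rightarrow> 'a ell2 \<Rightarrow> 'a ell2"
  where "scaleR_ell2 r v = complex_of_real r *\<^sub>C v"
definition uminus_ell2 :: "'a ell2 \<Rightarrow> 'a ell2"
  where "uminus_ell2 v = (- 1) *\<^sub>C v"
definition minus_ell2 :: "'a ell2 \<Rightarrow> 'a ell2 \<Rightarrow> 'a ell2"
  where "minus_ell2 v w = v + (- 1) *\<^sub>C w"
definition norm_ell2 :: "'a ell2 \<Rightarrow> real"
  where "norm_ell2 = ell2_norm"
definition dist_ell2 :: "'a ell2 \<Rightarrow> 'a ell2 \<Rightarrow> real"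
  where "dist_ell2 v w = norm (v - w)"
definition sgn_ell2 :: "'a ell2 \<Rightarrow> 'a ell2"
  where "sgn_ell2 v = inverse (norm v) *\<^sub>R v"
definition uniformity_ell2 :: "('a ell2 \<times> 'a ell2) filter"
  where "uniformity_ell2 = (INF e\<in>{0 <..}. principal {(x, y). dist x y < e})"
definition open_ell2 :: "'a ell2 set \<Rightarrow> bool"
  where "open_ell2 U \<longleftrightarrow> (\<forall>x\<in>U. \<forall>\<^sub>F (x', y) in uniformity. x' = x \<longrightarrow> y \<in> U)"

lemma ell2_norm_scaleC: "ell2_norm (c *\<^sub>C v) = cmod c * ell2_norm v"
  by (simp add: ell2_norm.rep_eq scaleC_ell2.rep_eq norm_mult power_mult_distrib
      infsum_cmult_right' real_sqrt_mult)

instance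
proof
  fix a b c :: "'a ell2" and r s :: real
  show "a + b + c = a + (b + c)" by transfer (simp add: add.assoc)
  show "a + b = b + a" by transfer (simp add: add.commute)
  show "0 + a = a" by transfer simp
  show "- a + a = 0" unfolding uminus_ell2_def by transfer simp
  show "a - b = a + - b" by (simp add: uminus_ell2_def minus_ell2_def)
  show "r *\<^sub>R (a + b) = r *\<^sub>R a + r *\<^sub>R b"
    unfolding scaleR_ell2_def by transfer (simp add: algebra_simps)
  show "(r + s) *\<^sub>R a = r *\<^sub>R a + s *\<^sub>R a"
    unfolding scaleR_ell2_def by transfer (simp add: algebra_simps)
  show "r *\<^sub>R s *\<^sub>R a = (r * s) *\<^sub>R a"
    unfolding scaleR_ell2_def by transfer (simp add: algebra_simps)
  show "1 *\<^sub>R a = a" unfolding scaleR_ell2_def by transfer simp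
  show "dist a b = norm (a - b)" by (rule dist_ell2_def)
  show "sgn a = inverse (norm a) *\<^sub>R a" by (rule sgn_ell2_def)
  show "uniformity = (INF e\<in>{0<..}. principal {(x :: 'a ell2, y). dist x y < e})"
    by (rule uniformity_ell2_def)
  show "open U = (\<forall>x\<in>U. \<forall>\<^sub>F (x', y) in uniformity. x' = x \<longrightarrow> y \<in> U)" for U :: "'a ell2 set"
    by (rule open_ell2_def)
  show "norm (a + b) \<le> norm a + norm b"
    unfolding norm_ell2_def
    by (rule ell2_norm_le)
      (auto simp: plus_ell2.rep_eq intro!: order_trans[OF L2_set_cmod_add_le] add_mono L2_set_le_ell2_norm)
  show "norm (r *\<^sub>R a) = \<bar>r\<bar> * norm a"
    by (simp add: norm_ell2_def scaleR_ell2_def ell2_norm_scaleC)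
  show "norm a = 0 \<longleftrightarrow> a = 0"
  proof
    assume n: "norm a = 0"
    have "cmod (ell2_fun a x) \<le> 0" for x
      using L2_set_le_ell2_norm[of a "{x}"] n by (simp add: norm_ell2_def)
    then show "a = 0" by transfer (auto simp: fun_eq_iff)
  next
    assume "a = 0"
    then show "norm a = 0" by (simp add: norm_ell2_def ell2_norm.rep_eq zero_ell2.rep_eq)
  qed
qed

end

instance ell2 :: (type) complex_normed_vector
proof
  fix c d :: complex and a b :: "'a ell2" and r :: real
  show "c *\<^sub>C (a + b) = c *\<^sub>C a + c *\<^sub>C b" by transfer (simp add: algebra_simps)
  show "(c + d) *\<^sub>C a = c *\<^sub>C a + d *\<^sub>C a" by transfer (simp add: algebra_simps)
  show "c *\<^sub>C d *\<^sub>C a = (c * d) *\<^sub>C a" by transfer (simp add: algebra_simps)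
  show "r *\<^sub>R a = complex_of_real r *\<^sub>C a" by (rule scaleR_ell2_def)
  show "norm (c *\<^sub>C a) = cmod c * norm a" by (simp add: norm_ell2_def ell2_norm_scaleC)
qed

lemma L2_set_le_norm_ell2: "L2_set (\<lambda>x. cmod (ell2_fun v x)) F \<le> norm v"
  by (simp add: norm_ell2_def L2_set_le_ell2_norm)

lemma ell2_fun_minus: "ell2_fun (v - w) x = ell2_fun v x - ell2_fun w x"
  by (simp add: minus_ell2_def plus_ell2.rep_eq scaleC_ell2.rep_eq)

lemma cmod_ell2_fun_le: "cmod (ell2_fun v x) \<le> norm v"
  using L2_set_le_norm_ell2[of v "{x}"] by simp

instance ell2 :: (type) banach
proof
  fix X :: "nat \<Rightarrow> 'a ell2"
  assume X: "Cauchy X"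
  have "Cauchy (\<lambda>n. ell2_fun (X n) x)" for x
  proof (rule metric_CauchyI)
    fix e :: real assume "e > 0"
    then obtain N where N: "\<forall>m\<ge>N. \<forall>n\<ge>N. dist (X m) (X n) < e"
      using X by (auto simp: Cauchy_def)
    show "\<exists>N. \<forall>m\<ge>N. \<forall>n\<ge>N. dist (ell2_fun (X m) x) (ell2_fun (X n) x) < e"
    proof (intro exI[of _ N] allI impI)
      fix m n assume "m \<ge> N" "n \<ge> N"
      then show "dist (ell2_fun (X m) x) (ell2_fun (X n) x) < e"
        using order.strict_trans1[OF cmod_ell2_fun_le[of "X m - X n" x]] N
        by (simp add: dist_norm ell2_fun_minus)
    qed
  qed
  then have "\<forall>x. \<exists>l. (\<lambda>n. ell2_fun (X n) x) \<longlonglongrightarrow> l"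
    using Cauchy_convergent unfolding convergent_def by blast
  then obtain f where f: "\<And>x. (\<lambda>n. ell2_fun (X n) x) \<longlonglongrightarrow> f x"
    using choice[of "\<lambda>x l. (\<lambda>n. ell2_fun (X n) x) \<longlonglongrightarrow> l"] by blast
  have tail: "\<exists>N. \<forall>n\<ge>N. \<forall>F. finite F \<longrightarrow> L2_set (\<lambda>x. cmod (ell2_fun (X n) x - f x)) F \<le> e"
    if "e > 0" for e :: real
  proof -
    obtain N where N: "\<forall>m\<ge>N. \<forall>n\<ge>N. dist (X m) (X n) < e"
      using X \<open>e > 0\<close> by (auto simp: Cauchy_def)
    have "L2_set (\<lambda>x. cmod (ell2_fun (X n) x - f x)) F \<le> e" if "n \<ge> N" "finite F" for n F
    proof (rule tendsto_upperbound)
      show "(\<lambda>m. L2_set (\<lambda>x. cmod (ell2_fun (X n) x - ell2_fun (X m) x)) F)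
          \<longlonglongrightarrow> L2_set (\<lambda>x. cmod (ell2_fun (X n) x - f x)) F"
        unfolding L2_set_def by (intro tendsto_intros f)
      show "\<forall>\<^sub>F m in sequentially. L2_set (\<lambda>x. cmod (ell2_fun (X n) x - ell2_fun (X m) x)) F \<le> e"
        using eventually_ge_at_top[of N]
      proof eventually_elim
        case (elim m)
        then show ?case
          using order_trans[OF L2_set_le_norm_ell2[of "X n - X m" F], of e] N \<open>n \<ge> N\<close>
          by (simp add: ell2_fun_minus dist_norm less_imp_le)
      qed
    qed simp
    then show ?thesis by blast
  qed
  obtain N where N: "\<forall>n\<ge>N. \<forall>F. finite F \<longrightarrow> L2_set (\<lambda>x. cmod (ell2_fun (X n) x - f x)) F \<le> 1"
    using tail[of 1] by auto
  have "L2_set (\<lambda>x. cmod (f x)) F \<le> 1 + norm (X N)" if "finite F" for F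
  proof -
    have "L2_set (\<lambda>x. cmod (f x)) F
        = L2_set (\<lambda>x. cmod ((- 1) * (ell2_fun (X N) x - f x) + ell2_fun (X N) x)) F"
      by (simp add: algebra_simps)
    also have "\<dots> \<le> L2_set (\<lambda>x. cmod ((- 1) * (ell2_fun (X N) x - f x))) F
        + L2_set (\<lambda>x. cmod (ell2_fun (X N) x)) F"
      by (rule L2_set_cmod_add_le)
    also have "\<dots> \<le> 1 + norm (X N)"
      using N that L2_set_le_norm_ell2[of "X N" F] unfolding L2_set_cmod_scale by (intro add_mono) auto
    finally show ?thesis .
  qed
  then have "(\<lambda>x. (cmod (f x))\<^sup>2) summable_on UNIV" by (rule ell2_normI(1))
  then obtain v where v: "ell2_fun v = f"
    by (metis Abs_ell2_inverse mem_Collect_eq)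
  have "X \<longlonglongrightarrow> v"
  proof (rule LIMSEQ_I)
    fix e :: real assume "e > 0"
    then obtain N where N: "\<forall>n\<ge>N. \<forall>F. finite F \<longrightarrow> L2_set (\<lambda>x. cmod (ell2_fun (X n) x - f x)) F \<le> e / 2"
      using tail[of "e / 2"] by auto
    have "norm (X n - v) \<le> e / 2" if "n \<ge> N" for n
      unfolding norm_ell2_def by (rule ell2_norm_le) (use N that in \<open>auto simp: ell2_fun_minus v\<close>)
    moreover have "e / 2 < e" using \<open>e > 0\<close> by simp
    ultimately show "\<exists>N. \<forall>n\<ge>N. norm (X n - v) < e"
      using order.strict_trans1 by blast
  qed
  then show "convergent X" by (auto simp: convergent_def)
qed

lift_definition cinner :: "'a ell2 \<Rightarrow> 'a ell2 \<Rightarrow> complex"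
  is "\<lambda>f g. \<Sum>\<^sub>\<infinity>x. f x * cnj (g x)" .

lemma cinner_summable:
  "(\<lambda>x. cmod (ell2_fun v x * cnj (ell2_fun w x))) summable_on UNIV"
  "cmod (cinner v w) \<le> norm v * norm w"
proof -
  have le: "(\<Sum>x\<in>F. cmod (ell2_fun v x * cnj (ell2_fun w x))) \<le> norm v * norm w" for F
  proof -
    have "(\<Sum>x\<in>F. cmod (ell2_fun v x * cnj (ell2_fun w x)))
        \<le> L2_set (\<lambda>x. cmod (ell2_fun v x)) F * L2_set (\<lambda>x. cmod (ell2_fun w x)) F"
      using L2_set_mult_ineq[of "\<lambda>x. cmod (ell2_fun v x)" "\<lambda>x. cmod (ell2_fun w x)" F]
      by (simp add: norm_mult)
    also have "\<dots> \<le> norm v * norm w"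
      by (intro mult_mono L2_set_le_norm_ell2) auto
    finally show ?thesis .
  qed
  show s: "(\<lambda>x. cmod (ell2_fun v x * cnj (ell2_fun w x))) summable_on UNIV"
    by (rule nonneg_bdd_above_summable_on) (auto intro!: bdd_aboveI[of _ "norm v * norm w"] le)
  have "cmod (cinner v w) \<le> (\<Sum>\<^sub>\<infinity>x. cmod (ell2_fun v x * cnj (ell2_fun w x)))"
    unfolding cinner.rep_eq using s by (rule norm_infsum_bound)
  also have "\<dots> \<le> norm v * norm w" by (intro infsum_le_finite_sums s le)
  finally show "cmod (cinner v w) \<le> norm v * norm w" .
qed

lemmas cinner_summable' = abs_summable_summable[OF cinner_summable(1)]

lemma cinner_add_left: "cinner (u + v) w = cinner u w + cinner v w"
  by (simp add: cinner.rep_eq plus_ell2.rep_eq distrib_right infsum_add cinner_summable')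

lemma cinner_add_right: "cinner u (v + w) = cinner u v + cinner u w"
  by (simp add: cinner.rep_eq plus_ell2.rep_eq distrib_left infsum_add cinner_summable')

lemma cinner_scaleC_left: "cinner (c *\<^sub>C v) w = c * cinner v w"
  by (simp add: cinner.rep_eq scaleC_ell2.rep_eq mult.assoc infsum_cmult_right')

lemma cinner_scaleC_right: "cinner v (c *\<^sub>C w) = cnj c * cinner v w"
  by (simp add: cinner.rep_eq scaleC_ell2.rep_eq mult.left_commute infsum_cmult_right')

lemma cinner_zero [simp]: "cinner 0 w = 0" "cinner w 0 = 0"
  by (simp_all add: cinner.rep_eq zero_ell2.rep_eq)

lemma cinner_sum_left: "cinner (sum f A) w = (\<Sum>x\<in>A. cinner (f x) w)"
  by (induction A rule: infinite_finite_induct) (auto simp: cinner_add_left)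

lemma cinner_sum_right: "cinner w (sum f A) = (\<Sum>x\<in>A. cinner w (f x))"
  by (induction A rule: infinite_finite_induct) (auto simp: cinner_add_right)

lemma cinner_self: "cinner v v = complex_of_real ((norm v)\<^sup>2)"
proof -
  have "((\<lambda>x. complex_of_real ((cmod (ell2_fun v x))\<^sup>2)) has_sum
      complex_of_real (\<Sum>\<^sub>\<infinity>x. (cmod (ell2_fun v x))\<^sup>2)) UNIV"
    using ell2_fun[of v] by (intro has_sum_of_real) auto
  then have "cinner v v = complex_of_real (\<Sum>\<^sub>\<infinity>x. (cmod (ell2_fun v x))\<^sup>2)"
    unfolding cinner.rep_eq complex_norm_square by (rule infsumI)
  then show ?thesis by (simp add: norm_ell2_def ell2_norm.rep_eq infsum_nonneg)
qed

section \<open>Bounded operators\<close>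

instantiation blinfun :: (real_normed_vector, complex_normed_vector) complex_normed_vector
begin

lift_definition scaleC_blinfun :: "complex \<Rightarrow> 'a \<Rightarrow>\<^sub>L 'b \<Rightarrow> 'a \<Rightarrow>\<^sub>L 'b" is "\<lambda>c T v. c *\<^sub>C T v"
proof -
  fix c :: complex and T :: "'a \<Rightarrow> 'b"
  assume "bounded_linear T"
  then interpret bounded_linear T .
  obtain K where K: "\<And>v. norm (T v) \<le> norm v * K" using bounded by auto
  show "bounded_linear (\<lambda>v. c *\<^sub>C T v)"
  proof (rule bounded_linear_intro[where K = "cmod c * K"])
    show "c *\<^sub>C T (x + y) = c *\<^sub>C T x + c *\<^sub>C T y" for x y
      by (simp add: add scaleC_add_right)
    show "c *\<^sub>C T (r *\<^sub>R x) = r *\<^sub>R c *\<^sub>C T x" for r x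
      by (simp add: scale scaleR_scaleC scaleC_scaleC mult.commute)
    show "norm (c *\<^sub>C T x) \<le> norm x * (cmod c * K)" for x
      using mult_left_mono[OF K[of x], of "cmod c"] by (simp add: norm_scaleC algebra_simps)
  qed
qed

instance
proof
  fix c d :: complex and S T :: "'a \<Rightarrow>\<^sub>L 'b" and r :: real
  show "c *\<^sub>C (S + T) = c *\<^sub>C S + c *\<^sub>C T" by transfer (simp add: scaleC_add_right)
  show "(c + d) *\<^sub>C T = c *\<^sub>C T + d *\<^sub>C T" by transfer (simp add: scaleC_add_left)
  show "c *\<^sub>C d *\<^sub>C T = (c * d) *\<^sub>C T" by transfer (simp add: scaleC_scaleC)
  show "r *\<^sub>R T = complex_of_real r *\<^sub>C T" by transfer (simp add: scaleR_scaleC)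
  have le: "norm (c *\<^sub>C T) \<le> cmod c * norm T" for c and T :: "'a \<Rightarrow>\<^sub>L 'b"
    by (rule norm_blinfun_bound)
      (auto simp: scaleC_blinfun.rep_eq norm_scaleC mult.assoc intro!: mult_left_mono norm_blinfun)
  show "norm (c *\<^sub>C T) = cmod c * norm T"
  proof (cases "c = 0")
    case True
    then show ?thesis using le[of 0 T] by simp
  next
    case False
    have "inverse c *\<^sub>C c *\<^sub>C T = T"
      using False by transfer (simp add: scaleC_scaleC)
    then have "norm T \<le> inverse (cmod c) * norm (c *\<^sub>C T)"
      using le[of "inverse c" "c *\<^sub>C T"] by (simp add: norm_inverse)
    then have "cmod c * norm T \<le> norm (c *\<^sub>C T)"
      using False by (simp add: field_simps)
    then show ?thesis using le[of c T] by simp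
  qed
qed

end

lemma blinfun_apply_scaleC:
  fixes T :: "'a::real_normed_vector \<Rightarrow>\<^sub>L 'b::complex_normed_vector"
  shows "blinfun_apply (c *\<^sub>C T) v = c *\<^sub>C blinfun_apply T v"
  by (simp add: scaleC_blinfun.rep_eq)

definition is_adjoint :: "('a ell2 \<Rightarrow>\<^sub>L 'a ell2) \<Rightarrow> ('a ell2 \<Rightarrow>\<^sub>L 'a ell2) \<Rightarrow> bool"
  where "is_adjoint S T \<longleftrightarrow> (\<forall>v w. cinner (S v) w = cinner v (T w))"

section \<open>The group algebra and its unitary representations\<close>

text \<open>
  A discrete group is a type of class \<^class>\<open>group_add\<close>, whose operation is written additively but is
  not assumed to be commutative. Its complex group algebra is \<^typ>\<open>'g \<Rightarrow>\<^sub>0 complex\<close> with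
  the convolution product of the library.
\<close>

definition ga_scale :: "complex \<Rightarrow> ('g \<Rightarrow>\<^sub>0 complex) \<Rightarrow> ('g \<Rightarrow>\<^sub>0 complex)"
  where "ga_scale c = Poly_Mapping.map ((*) c)"

lift_definition ga_star :: "('g::group_add \<Rightarrow>\<^sub>0 complex) \<Rightarrow> ('g \<Rightarrow>\<^sub>0 complex)"
  is "\<lambda>f g. cnj (f (- g))"
proof -
  fix f :: "'g \<Rightarrow> complex"
  assume "finite {g. f g \<noteq> 0}"
  then have "finite (uminus ` {g. f g \<noteq> 0})" by simp
  moreover have "{g. cnj (f (- g)) \<noteq> 0} \<subseteq> uminus ` {g. f g \<noteq> 0}"
    by (auto intro!: image_eqI[of _ uminus "- _"])
  ultimately show "finite {g. cnj (f (- g)) \<noteq> 0}" by (rule finite_subset[rotated])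
qed

definition unitary_rep :: "('g::group_add \<Rightarrow> 'h ell2 \<Rightarrow>\<^sub>L 'h ell2) \<Rightarrow> bool" where
  "unitary_rep \<pi> \<longleftrightarrow> \<pi> 0 = id_blinfun \<and> (\<forall>g h. \<pi> (g + h) = \<pi> g o\<^sub>L \<pi> h) \<and>
    (\<forall>g c v. \<pi> g (c *\<^sub>C v) = c *\<^sub>C \<pi> g v) \<and> (\<forall>g v w. cinner (\<pi> g v) (\<pi> g w) = cinner v w)"

definition rep_ext :: "('g \<Rightarrow> 'h ell2 \<Rightarrow>\<^sub>L 'h ell2) \<Rightarrow> ('g \<Rightarrow>\<^sub>0 complex) \<Rightarrow> 'h ell2 \<Rightarrow>\<^sub>L 'h ell2"
  where "rep_ext \<pi> f = (\<Sum>g\<in>Poly_Mapping.keys f. Poly_Mapping.lookup f g *\<^sub>C \<pi> g)"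

text \<open>
  The universal norm. Representations on the single space of square-summable families indexed by
  \<^typ>\<open>'g \<times> nat\<close> suffice: the norm of the group algebra element in an arbitrary unitary
  representation is the supremum over its cyclic subrepresentations; the space of a cyclic
  representation has dimension at most the cardinality of \<^typ>\<open>'g \<times> nat\<close>, and the Hilbert
  space tensor product with that index space has exactly this dimension and gives the same norm.
\<close>

definition unorm :: "('g::group_add \<Rightarrow>\<^sub>0 complex) \<Rightarrow> real" where
  "unorm f = (SUP \<pi>\<in>{\<pi> :: 'g \<Rightarrow> ('g \<times> nat) ell2 \<Rightarrow>\<^sub>L ('g \<times> nat) ell2. unitary_rep \<pi>}. norm (rep_ext \<pi> f))"

lemma lookup_ga_scale [simp]: "Poly_Mapping.lookup (ga_scale c f) g = c * Poly_Mapping.lookup f g"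
  by (simp add: ga_scale_def Poly_Mapping.map.rep_eq when_def)

lemma ga_scale_mult: "ga_scale c (f * h) = ga_scale c f * (h :: 'g::group_add \<Rightarrow>\<^sub>0 complex)"
  by (simp add: ga_scale_def mult_map_scale_conv_mult mult.assoc)

lemma ga_scale_add: "ga_scale c (f + h) = ga_scale c f + ga_scale c h"
  by (rule poly_mapping_eqI) (simp add: lookup_add algebra_simps)

lemma ga_scale_diff: "ga_scale c (f - h) = ga_scale c f - ga_scale c h"
  by (rule poly_mapping_eqI) (simp add: lookup_minus algebra_simps)

lemma lookup_ga_star [simp]: "Poly_Mapping.lookup (ga_star f) g = cnj (Poly_Mapping.lookup f (- g))"
  by (rule ga_star.rep_eq[THEN fun_cong])

lemma ga_star_add: "ga_star (f + h) = ga_star f + ga_star h"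
  by (rule poly_mapping_eqI) (simp add: lookup_add)

lemma ga_star_diff: "ga_star (f - h) = ga_star f - ga_star h"
  by (rule poly_mapping_eqI) (simp add: lookup_minus)

lemma ga_star_scale: "ga_star (ga_scale c f) = ga_scale (cnj c) (ga_star f)"
  by (rule poly_mapping_eqI) simp

lemma ga_single_sum: "f = (\<Sum>g\<in>Poly_Mapping.keys f. Poly_Mapping.single g (Poly_Mapping.lookup f g))"
  by (rule poly_mapping_eqI)
    (auto simp: lookup_sum lookup_single when_def in_keys_iff sum.delta' if_distrib cong: if_cong)

lemma ga_scale_mult_right: "f * ga_scale c h = ga_scale c (f * (h :: 'g::group_add \<Rightarrow>\<^sub>0 complex))"
proof -
  have "(\<Sum>g\<in>Poly_Mapping.keys f. Poly_Mapping.single g (Poly_Mapping.lookup f g)) * Poly_Mapping.single 0 c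
      = Poly_Mapping.single 0 c * (\<Sum>g\<in>Poly_Mapping.keys f. Poly_Mapping.single g (Poly_Mapping.lookup f g))"
    by (simp add: sum_distrib_left sum_distrib_right mult_single mult.commute)
  then have "f * Poly_Mapping.single 0 c = Poly_Mapping.single 0 c * f"
    by (simp only: ga_single_sum[symmetric])
  then show ?thesis
    by (simp add: ga_scale_def mult_map_scale_conv_mult flip: mult.assoc)
qed

lemma ga_star_star [simp]: "ga_star (ga_star f) = f"
  by (rule poly_mapping_eqI) simp

lemma ga_star_single: "ga_star (Poly_Mapping.single g c) = Poly_Mapping.single (- g) (cnj c)"
  by (rule poly_mapping_eqI) (auto simp: lookup_single when_def equation_minus_iff minus_equation_iff)

lemma ga_star_sum: "ga_star (sum F A) = (\<Sum>x\<in>A. ga_star (F x))"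
proof (induction A rule: infinite_finite_induct)
  case (insert x F)
  then show ?case by (simp add: ga_star_add)
qed (auto intro!: poly_mapping_eqI)

lemma ga_star_mult: "ga_star (f * h) = ga_star h * ga_star f"
proof -
  have "ga_star (f * h) = (\<Sum>x\<in>Poly_Mapping.keys f. \<Sum>y\<in>Poly_Mapping.keys h.
      ga_star (Poly_Mapping.single x (Poly_Mapping.lookup f x) * Poly_Mapping.single y (Poly_Mapping.lookup h y)))"
    by (subst ga_single_sum[of f], subst ga_single_sum[of h])
      (simp only: sum_distrib_left sum_distrib_right ga_star_sum sum.swap[of _ "Poly_Mapping.keys f" "Poly_Mapping.keys h"])
  also have "\<dots> = (\<Sum>x\<in>Poly_Mapping.keys f. \<Sum>y\<in>Poly_Mapping.keys h.
      ga_star (Poly_Mapping.single y (Poly_Mapping.lookup h y)) * ga_star (Poly_Mapping.single x (Poly_Mapping.lookup f x)))"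
    by (simp add: mult_single ga_star_single minus_add mult.commute)
  also have "\<dots> = ga_star (\<Sum>y\<in>Poly_Mapping.keys h. Poly_Mapping.single y (Poly_Mapping.lookup h y))
      * ga_star (\<Sum>x\<in>Poly_Mapping.keys f. Poly_Mapping.single x (Poly_Mapping.lookup f x))"
    by (simp only: sum_distrib_left sum_distrib_right ga_star_sum)
  finally show ?thesis using ga_single_sum[of f] ga_single_sum[of h] by simp
qed

lemma rep_ext_superset:
  assumes "finite A" "Poly_Mapping.keys f \<subseteq> A"
  shows "rep_ext \<pi> f = (\<Sum>g\<in>A. Poly_Mapping.lookup f g *\<^sub>C \<pi> g)"
  unfolding rep_ext_def by (rule sum.mono_neutral_left) (use assms in \<open>auto simp: in_keys_iff\<close>)

lemma rep_ext_add: "rep_ext \<pi> (f + h) = rep_ext \<pi> f + rep_ext \<pi> h"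
  using keys_add[of f h]
  by (simp add: rep_ext_superset[of "Poly_Mapping.keys f \<union> Poly_Mapping.keys h"] lookup_add
      scaleC_add_left sum.distrib)

lemma rep_ext_scale: "rep_ext \<pi> (ga_scale c f) = c *\<^sub>C rep_ext \<pi> f"
  by (subst rep_ext_superset[of "Poly_Mapping.keys f"])
    (auto simp: rep_ext_def scaleC_sum_right scaleC_scaleC in_keys_iff)

lemma ga_uminus: "- f = ga_scale (- 1) f"
  by (rule poly_mapping_eqI) simp

lemma rep_ext_zero [simp]: "rep_ext \<pi> 0 = 0"
  by (simp add: rep_ext_def)

lemma scaleC_minus_one: "(- 1) *\<^sub>C x = - (x :: 'a :: complex_normed_vector)"
  using scaleR_scaleC[of "-1" x] by simp

lemma rep_ext_diff: "rep_ext \<pi> (f - h) = rep_ext \<pi> f - rep_ext \<pi> h"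
  using rep_ext_add[of \<pi> f "- h"] rep_ext_scale[of \<pi> "- 1" h]
  by (simp add: scaleC_minus_one flip: ga_uminus)

lemma rep_ext_sum: "rep_ext \<pi> (sum F A) = (\<Sum>x\<in>A. rep_ext \<pi> (F x))"
  by (induction A rule: infinite_finite_induct) (auto simp: rep_ext_add)

lemma rep_ext_single: "rep_ext \<pi> (Poly_Mapping.single g c) = c *\<^sub>C \<pi> g"
  by (subst rep_ext_superset[of "{g}"]) auto

context
  fixes \<pi> :: "'g::group_add \<Rightarrow> 'h ell2 \<Rightarrow>\<^sub>L 'h ell2"
  assumes \<pi>: "unitary_rep \<pi>"
begin

lemma unitary_rep_zero: "\<pi> 0 = id_blinfun"
  and unitary_rep_add: "\<pi> (g + h) = \<pi> g o\<^sub>L \<pi> h"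
  and unitary_rep_scaleC: "\<pi> g (c *\<^sub>C v) = c *\<^sub>C \<pi> g v"
  and unitary_rep_cinner: "cinner (\<pi> g v) (\<pi> g w) = cinner v w"
  using \<pi> by (auto simp: unitary_rep_def)

lemma unitary_rep_norm: "norm (\<pi> g v) = norm v"
proof -
  have "complex_of_real ((norm (\<pi> g v))\<^sup>2) = complex_of_real ((norm v)\<^sup>2)"
    using unitary_rep_cinner[of g v v] unfolding cinner_self .
  then show ?thesis by (simp del: of_real_power)
qed

lemma unitary_rep_adjoint: "cinner (\<pi> g v) w = cinner v (\<pi> (- g) w)"
proof -
  have "\<pi> g (\<pi> (- g) w) = w"
    using unitary_rep_add[of g "- g"] by (simp add: unitary_rep_zero flip: blinfun_apply_blinfun_compose)
  then show ?thesis using unitary_rep_cinner[of g v "\<pi> (- g) w"] by simp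
qed

lemma rep_ext_norm_le: "norm (rep_ext \<pi> f) \<le> (\<Sum>g\<in>Poly_Mapping.keys f. cmod (Poly_Mapping.lookup f g))"
proof -
  have "norm (\<pi> g) \<le> 1" for g
    by (rule norm_blinfun_bound) (auto simp: unitary_rep_norm)
  then show ?thesis
    unfolding rep_ext_def
    by (intro sum_norm_le) (simp add: norm_scaleC mult_left_le)
qed

lemma rep_ext_mult: "rep_ext \<pi> (f * h) = rep_ext \<pi> f o\<^sub>L rep_ext \<pi> h"
proof -
  have *: "(a *\<^sub>C \<pi> x) o\<^sub>L (b *\<^sub>C \<pi> y) = (a * b) *\<^sub>C \<pi> (x + y)" for a b x y
    by (rule blinfun_eqI) (simp add: blinfun_apply_scaleC unitary_rep_scaleC scaleC_scaleC unitary_rep_add)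
  have "rep_ext \<pi> (f * h) = (\<Sum>x\<in>Poly_Mapping.keys f. \<Sum>y\<in>Poly_Mapping.keys h.
      rep_ext \<pi> (Poly_Mapping.single x (Poly_Mapping.lookup f x) * Poly_Mapping.single y (Poly_Mapping.lookup h y)))"
    by (subst ga_single_sum[of f], subst ga_single_sum[of h])
      (simp only: sum_distrib_left sum_distrib_right rep_ext_sum sum.swap[of _ "Poly_Mapping.keys f" "Poly_Mapping.keys h"])
  also have "\<dots> = (\<Sum>x\<in>Poly_Mapping.keys f. \<Sum>y\<in>Poly_Mapping.keys h.
      (Poly_Mapping.lookup f x *\<^sub>C \<pi> x) o\<^sub>L (Poly_Mapping.lookup h y *\<^sub>C \<pi> y))"
    by (simp add: mult_single rep_ext_single *)
  also have "\<dots> = rep_ext \<pi> f o\<^sub>L rep_ext \<pi> h"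
    by (simp add: rep_ext_def bounded_bilinear.sum_left[OF bounded_bilinear_blinfun_compose]
        bounded_bilinear.sum_right[OF bounded_bilinear_blinfun_compose]
        sum.swap[of _ "Poly_Mapping.keys f" "Poly_Mapping.keys h"])
  finally show ?thesis .
qed

lemma rep_ext_star: "is_adjoint (rep_ext \<pi> f) (rep_ext \<pi> (ga_star f))"
proof -
  have "ga_star f = (\<Sum>g\<in>Poly_Mapping.keys f. Poly_Mapping.single (- g) (cnj (Poly_Mapping.lookup f g)))"
    using arg_cong[OF ga_single_sum[of f], of ga_star] by (simp only: ga_star_sum ga_star_single)
  then have "rep_ext \<pi> (ga_star f) = (\<Sum>g\<in>Poly_Mapping.keys f. cnj (Poly_Mapping.lookup f g) *\<^sub>C \<pi> (- g))"
    by (simp only: rep_ext_sum rep_ext_single)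
  then show ?thesis
    by (simp add: is_adjoint_def rep_ext_def blinfun.sum_left cinner_sum_left cinner_sum_right
        blinfun_apply_scaleC cinner_scaleC_left cinner_scaleC_right unitary_rep_adjoint)
qed

lemma rep_ext_cstar: "norm (rep_ext \<pi> (ga_star f * f)) = (norm (rep_ext \<pi> f))\<^sup>2"
  and rep_ext_norm_star: "norm (rep_ext \<pi> (ga_star f)) = norm (rep_ext \<pi> f)"
proof -
  have adj: "cinner (rep_ext \<pi> f v) (rep_ext \<pi> f v) = cinner v (rep_ext \<pi> (ga_star f * f) v)" for f v
    using rep_ext_star[of f] by (simp add: is_adjoint_def rep_ext_mult)
  have 1: "(norm (rep_ext \<pi> f))\<^sup>2 \<le> norm (rep_ext \<pi> (ga_star f * f))" for f
  proof -
    have "norm (rep_ext \<pi> f v) \<le> sqrt (norm (rep_ext \<pi> (ga_star f * f))) * norm v" for v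
    proof -
      have "(norm (rep_ext \<pi> f v))\<^sup>2 = cmod (cinner v (rep_ext \<pi> (ga_star f * f) v))"
        by (simp add: cinner_self norm_power flip: adj)
      also have "\<dots> \<le> norm v * norm (rep_ext \<pi> (ga_star f * f) v)" by (rule cinner_summable(2))
      also have "\<dots> \<le> norm v * (norm (rep_ext \<pi> (ga_star f * f)) * norm v)"
        by (intro mult_left_mono norm_blinfun) auto
      also have "\<dots> = (sqrt (norm (rep_ext \<pi> (ga_star f * f))) * norm v)\<^sup>2"
        by (simp add: power_mult_distrib power2_eq_square)
      finally show ?thesis by (rule power2_le_imp_le) simp
    qed
    then have "norm (rep_ext \<pi> f) \<le> sqrt (norm (rep_ext \<pi> (ga_star f * f)))"
      by (intro norm_blinfun_bound) auto
    then show ?thesis using power_mono[of "norm (rep_ext \<pi> f)" _ 2] by fastforce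
  qed
  have 2: "norm (rep_ext \<pi> (ga_star f * f)) \<le> norm (rep_ext \<pi> (ga_star f)) * norm (rep_ext \<pi> f)" for f
    unfolding rep_ext_mult by (rule norm_blinfun_compose)
  have 3: "norm (rep_ext \<pi> f) \<le> norm (rep_ext \<pi> (ga_star f))" for f
  proof (cases "norm (rep_ext \<pi> f) = 0")
    case False
    then have "norm (rep_ext \<pi> f) > 0" by simp
    moreover have "norm (rep_ext \<pi> f) * norm (rep_ext \<pi> f) \<le> norm (rep_ext \<pi> (ga_star f)) * norm (rep_ext \<pi> f)"
      using order_trans[OF 1[of f] 2[of f]] by (simp add: power2_eq_square)
    ultimately show ?thesis by (simp only: mult_le_cancel_right)
  qed auto
  show 4: "norm (rep_ext \<pi> (ga_star f)) = norm (rep_ext \<pi> f)"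
    using 3[of f] 3[of "ga_star f"] by simp
  show "norm (rep_ext \<pi> (ga_star f * f)) = (norm (rep_ext \<pi> f))\<^sup>2"
    using 1[of f] 2[of f] 4 by (simp add: power2_eq_square)
qed

end

lemma unitary_rep_trivial: "unitary_rep (\<lambda>_. id_blinfun)"
  by (auto simp: unitary_rep_def intro!: blinfun_eqI)

lemma rep_ext_le_unorm:
  fixes \<pi> :: "'g::group_add \<Rightarrow> ('g \<times> nat) ell2 \<Rightarrow>\<^sub>L ('g \<times> nat) ell2"
  assumes "unitary_rep \<pi>"
  shows "norm (rep_ext \<pi> f) \<le> unorm f"
  unfolding unorm_def
  by (rule cSUP_upper) (use assms in \<open>auto intro!: bdd_aboveI2 rep_ext_norm_le\<close>)

lemma unorm_le:
  fixes f :: "'g::group_add \<Rightarrow>\<^sub>0 complex"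
  assumes "\<And>\<pi> :: 'g \<Rightarrow> ('g \<times> nat) ell2 \<Rightarrow>\<^sub>L ('g \<times> nat) ell2. unitary_rep \<pi> \<Longrightarrow> norm (rep_ext \<pi> f) \<le> B"
  shows "unorm f \<le> B"
  unfolding unorm_def using assms unitary_rep_trivial by (intro cSUP_least) auto

lemma unorm_nonneg [simp]: "unorm f \<ge> 0"
  by (rule order_trans[OF norm_ge_zero rep_ext_le_unorm[OF unitary_rep_trivial]])

lemma unorm_add: "unorm (f + h) \<le> unorm f + unorm h"
  by (rule unorm_le)
    (auto simp: rep_ext_add intro!: order_trans[OF norm_triangle_ineq] add_mono rep_ext_le_unorm)

lemma unorm_scale: "unorm (ga_scale c f) = cmod c * unorm f"
proof -
  have le: "unorm (ga_scale c f) \<le> cmod c * unorm f" for c and f :: "'g::group_add \<Rightarrow>\<^sub>0 complex"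
    by (rule unorm_le) (auto simp: rep_ext_scale norm_scaleC intro!: mult_left_mono rep_ext_le_unorm)
  show ?thesis
  proof (cases "c = 0")
    case True
    then show ?thesis using le[of c f] by (auto intro!: antisym)
  next
    case False
    have "ga_scale (inverse c) (ga_scale c f) = f"
      using False by (intro poly_mapping_eqI) simp
    then have "unorm f \<le> inverse (cmod c) * unorm (ga_scale c f)"
      using le[of "inverse c" "ga_scale c f"] by (simp add: norm_inverse)
    then have "cmod c * unorm f \<le> unorm (ga_scale c f)"
      using False by (simp add: field_simps)
    then show ?thesis using le[of c f] by simp
  qed
qed

lemma unorm_zero [simp]: "unorm (0 :: 'a::group_add \<Rightarrow>\<^sub>0 complex) = 0"
proof -
  have "ga_scale 0 0 = (0 :: 'a \<Rightarrow>\<^sub>0 complex)" by (rule poly_mapping_eqI) simp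
  then show ?thesis using unorm_scale[of 0 "0 :: 'a \<Rightarrow>\<^sub>0 complex"] by simp
qed

lemma unorm_uminus [simp]: "unorm (- f) = unorm f"
  unfolding ga_uminus unorm_scale by simp

lemma unorm_minus_commute: "unorm (f - h) = unorm (h - f)"
  using unorm_uminus[of "f - h"] by simp

lemma unorm_diff_triangle: "unorm (f - k) \<le> unorm (f - h) + unorm (h - k)"
  using unorm_add[of "f - h" "h - k"] by simp

lemma unorm_diff: "\<bar>unorm f - unorm h\<bar> \<le> unorm (f - h)"
  using unorm_add[of "f - h" h] unorm_add[of "h - f" f] unorm_minus_commute[of f h] by simp

lemma unorm_mult: "unorm (f * h) \<le> unorm f * unorm h"
  by (rule unorm_le)
    (auto simp: rep_ext_mult intro!: order_trans[OF norm_blinfun_compose] mult_mono rep_ext_le_unorm)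

lemma unorm_star: "unorm (ga_star f) = unorm f"
proof -
  have "unorm (ga_star f) \<le> unorm f" for f :: "'g::group_add \<Rightarrow>\<^sub>0 complex"
    by (rule unorm_le) (simp add: rep_ext_norm_star rep_ext_le_unorm)
  from this[of f] this[of "ga_star f"] show ?thesis by simp
qed

lemma unorm_cstar: "unorm (ga_star f * f) = (unorm f)\<^sup>2"
proof (rule antisym)
  show "unorm (ga_star f * f) \<le> (unorm f)\<^sup>2"
    using unorm_mult[of "ga_star f" f] by (simp add: unorm_star power2_eq_square)
  have "unorm f \<le> sqrt (unorm (ga_star f * f))"
    by (rule unorm_le, rule real_le_rsqrt) (simp add: rep_ext_le_unorm flip: rep_ext_cstar)
  then show "(unorm f)\<^sup>2 \<le> unorm (ga_star f * f)"
    using power_mono[of "unorm f" _ 2] by fastforce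
qed

lemma unorm_single: "unorm (Poly_Mapping.single g c) \<le> cmod c"
  by (rule unorm_le) (rule order_trans[OF rep_ext_norm_le], auto)

lemma unorm_one [simp]: "unorm (1 :: 'a::group_add \<Rightarrow>\<^sub>0 complex) = 1"
proof (rule antisym)
  show "unorm (1 :: 'a \<Rightarrow>\<^sub>0 complex) \<le> 1"
    using unorm_single[of 0 1] by simp
  have "unorm (1 :: 'a \<Rightarrow>\<^sub>0 complex) = (unorm (1 :: 'a \<Rightarrow>\<^sub>0 complex))\<^sup>2"
    using unorm_cstar[of "1 :: 'a \<Rightarrow>\<^sub>0 complex"] ga_star_single[of "0 :: 'a" 1] by simp
  moreover have "unorm (1 :: 'a \<Rightarrow>\<^sub>0 complex) \<noteq> 0"
  proof
    assume 0: "unorm (1 :: 'a \<Rightarrow>\<^sub>0 complex) = 0"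
    obtain v :: "('a \<times> nat) ell2" where v: "v \<noteq> 0"
    proof -
      have "(\<lambda>x. (cmod (if x = (0 :: 'a, 0 :: nat) then 1 else 0))\<^sup>2) summable_on UNIV"
        by (rule finite_nonzero_values_imp_summable_on)
          (rule finite_subset[of _ "{(0, 0)}"], auto)
      then have "ell2_fun (Abs_ell2 (\<lambda>x. if x = (0 :: 'a, 0 :: nat) then 1 else 0)) (0, 0) = 1"
        by (simp add: Abs_ell2_inverse)
      then show ?thesis using that by (metis zero_ell2.rep_eq zero_neq_one)
    qed
    have "rep_ext (\<lambda>_. id_blinfun :: ('a \<times> nat) ell2 \<Rightarrow>\<^sub>L _) (1 :: 'a \<Rightarrow>\<^sub>0 complex) = 0"
      using rep_ext_le_unorm[OF unitary_rep_trivial, of "1 :: 'a \<Rightarrow>\<^sub>0 complex"] 0 by simp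
    moreover have "rep_ext (\<lambda>_. id_blinfun :: ('a \<times> nat) ell2 \<Rightarrow>\<^sub>L _) (1 :: 'a \<Rightarrow>\<^sub>0 complex) = id_blinfun"
      using rep_ext_single[of "\<lambda>_. id_blinfun" "0 :: 'a" 1] by simp
    ultimately have "blinfun_apply (id_blinfun :: ('a \<times> nat) ell2 \<Rightarrow>\<^sub>L _) v = blinfun_apply 0 v" by simp
    then show False using v by simp
  qed
  ultimately show "1 \<le> unorm (1 :: 'a \<Rightarrow>\<^sub>0 complex)" by (simp add: power2_eq_square)
qed

section \<open>The full group C*-algebra\<close>

definition ga_Cauchy :: "(nat \<Rightarrow> ('g::group_add \<Rightarrow>\<^sub>0 complex)) \<Rightarrow> bool"
  where "ga_Cauchy X \<longleftrightarrow> (\<forall>e>0. \<exists>N. \<forall>m\<ge>N. \<forall>n\<ge>N. unorm (X m - X n) < e)"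

definition ga_equiv :: "(nat \<Rightarrow> ('g::group_add \<Rightarrow>\<^sub>0 complex)) \<Rightarrow> (nat \<Rightarrow> ('g \<Rightarrow>\<^sub>0 complex)) \<Rightarrow> bool"
  where "ga_equiv X Y \<longleftrightarrow> ga_Cauchy X \<and> ga_Cauchy Y \<and> (\<lambda>n. unorm (X n - Y n)) \<longlonglongrightarrow> 0"

lemma ga_Cauchy_const: "ga_Cauchy (\<lambda>_. f)"
  by (simp add: ga_Cauchy_def)

lemma ga_equiv_refl: "ga_Cauchy X \<Longrightarrow> ga_equiv X X"
  by (simp add: ga_equiv_def)

lemma part_equivp_ga_equiv: "part_equivp (ga_equiv :: (nat \<Rightarrow> ('g::group_add \<Rightarrow>\<^sub>0 complex)) \<Rightarrow> _)"
proof (rule part_equivpI)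
  show "\<exists>X :: nat \<Rightarrow> ('g::group_add \<Rightarrow>\<^sub>0 complex). ga_equiv X X"
    using ga_equiv_refl[OF ga_Cauchy_const] by blast
  show "symp (ga_equiv :: (nat \<Rightarrow> ('g::group_add \<Rightarrow>\<^sub>0 complex)) \<Rightarrow> _)"
    by (rule sympI) (simp add: ga_equiv_def unorm_minus_commute)
  show "transp (ga_equiv :: (nat \<Rightarrow> ('g::group_add \<Rightarrow>\<^sub>0 complex)) \<Rightarrow> _)"
  proof (rule transpI)
    fix X Y Z :: "nat \<Rightarrow> ('g::group_add \<Rightarrow>\<^sub>0 complex)"
    assume "ga_equiv X Y" "ga_equiv Y Z"
    then have XYZ: "ga_Cauchy X" "ga_Cauchy Z"
      and lim: "(\<lambda>n. unorm (X n - Y n) + unorm (Y n - Z n)) \<longlonglongrightarrow> 0"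
      by (auto simp: ga_equiv_def intro: tendsto_add_zero)
    have "(\<lambda>n. unorm (X n - Z n)) \<longlonglongrightarrow> 0"
      by (rule tendsto_sandwich[OF _ _ tendsto_const lim])
        (simp_all add: always_eventually unorm_diff_triangle)
    with XYZ show "ga_equiv X Z" by (simp add: ga_equiv_def)
  qed
qed

text \<open>The completion of the group algebra with respect to the universal norm.\<close>

quotient_type (overloaded) 'g group_cstar = "nat \<Rightarrow> ('g::group_add \<Rightarrow>\<^sub>0 complex)" / partial: ga_equiv
  by (rule part_equivp_ga_equiv)

lemma ga_CauchyI:
  assumes "ga_Cauchy X" "\<And>m n. unorm (Y m - Y n) \<le> C * unorm (X m - X n)"
  shows "ga_Cauchy Y"
  unfolding ga_Cauchy_def
proof (intro allI impI)
  fix e :: real assume "e > 0"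
  then have "e / (\<bar>C\<bar> + 1) > 0" by simp
  then obtain N where N: "\<forall>m\<ge>N. \<forall>n\<ge>N. unorm (X m - X n) < e / (\<bar>C\<bar> + 1)"
    using assms(1) unfolding ga_Cauchy_def by blast
  have "unorm (Y m - Y n) < e" if "m \<ge> N" "n \<ge> N" for m n
  proof -
    have "C * unorm (X m - X n) \<le> (\<bar>C\<bar> + 1) * unorm (X m - X n)"
      by (rule mult_right_mono) auto
    also have "\<dots> < e" using N that by (simp add: field_simps)
    finally show ?thesis using assms(2)[of m n] by linarith
  qed
  then show "\<exists>N. \<forall>m\<ge>N. \<forall>n\<ge>N. unorm (Y m - Y n) < e" by blast
qed

lemma ga_Cauchy_scale:
  assumes "ga_Cauchy X"
  shows "ga_Cauchy (\<lambda>n. ga_scale c (X n))"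
  by (rule ga_CauchyI[OF assms, where C = "cmod c"]) (simp add: unorm_scale flip: ga_scale_diff)

lemma ga_Cauchy_star:
  assumes "ga_Cauchy X"
  shows "ga_Cauchy (\<lambda>n. ga_star (X n))"
  by (rule ga_CauchyI[OF assms, where C = 1]) (simp add: unorm_star flip: ga_star_diff)

lemma ga_Cauchy_add:
  assumes "ga_Cauchy X" "ga_Cauchy Y"
  shows "ga_Cauchy (\<lambda>n. X n + Y n)"
  unfolding ga_Cauchy_def
proof (intro allI impI)
  fix e :: real assume "e > 0"
  then have "e / 2 > 0" by simp
  then obtain M N where MN: "\<forall>m\<ge>M. \<forall>n\<ge>M. unorm (X m - X n) < e / 2"
    "\<forall>m\<ge>N. \<forall>n\<ge>N. unorm (Y m - Y n) < e / 2"
    using assms unfolding ga_Cauchy_def by meson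
  have "unorm (X m + Y m - (X n + Y n)) < e" if "m \<ge> max M N" "n \<ge> max M N" for m n
  proof -
    have "unorm (X m - X n) < e / 2" "unorm (Y m - Y n) < e / 2" using MN that by auto
    then show ?thesis using unorm_add[of "X m - X n" "Y m - Y n"] by (simp add: algebra_simps)
  qed
  then show "\<exists>N. \<forall>m\<ge>N. \<forall>n\<ge>N. unorm (X m + Y m - (X n + Y n)) < e" by blast
qed

lemma ga_Cauchy_bounded:
  assumes "ga_Cauchy X"
  obtains B where "B > 0" "\<And>n. unorm (X n) \<le> B"
proof -
  obtain N where N: "\<forall>m\<ge>N. \<forall>n\<ge>N. unorm (X m - X n) < 1"
    using assms unfolding ga_Cauchy_def by (meson zero_less_one)
  define B where "B = 1 + unorm (X N) + (\<Sum>n<N. unorm (X n))"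
  have s: "(\<Sum>n<N. unorm (X n)) \<ge> 0" by (simp add: sum_nonneg)
  have "unorm (X n) \<le> B" for n
  proof (cases "n < N")
    case True
    then have "unorm (X n) \<le> (\<Sum>n<N. unorm (X n))"
      by (intro member_le_sum) auto
    then show ?thesis unfolding B_def using unorm_nonneg[of "X N"] by linarith
  next
    case False
    then have "unorm (X n - X N) < 1" using N by simp
    then show ?thesis unfolding B_def using unorm_add[of "X n - X N" "X N"] s by simp
  qed
  moreover have "B > 0" using s unorm_nonneg[of "X N"] unfolding B_def by linarith
  ultimately show ?thesis using that by blast
qed

lemma unorm_mult_diff:
  "unorm (f * h - f' * h') \<le> unorm f * unorm (h - h') + unorm (f - f') * unorm h'"
proof -
  have "f * h - f' * h' = f * (h - h') + (f - f') * h'" by (simp add: algebra_simps)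
  then show ?thesis
    using order_trans[OF unorm_add add_mono[OF unorm_mult unorm_mult]] by metis
qed

lemma ga_Cauchy_mult:
  assumes "ga_Cauchy X" "ga_Cauchy Y"
  shows "ga_Cauchy (\<lambda>n. X n * Y n)"
  unfolding ga_Cauchy_def
proof (intro allI impI)
  fix e :: real assume e: "e > 0"
  obtain B where B: "B > 0" "\<And>n. unorm (X n) \<le> B" using ga_Cauchy_bounded[OF assms(1)] by blast
  obtain C where C: "C > 0" "\<And>n. unorm (Y n) \<le> C" using ga_Cauchy_bounded[OF assms(2)] by blast
  have "e / (2 * B) > 0" "e / (2 * C) > 0" using e B C by auto
  then obtain M N where MN: "\<forall>m\<ge>M. \<forall>n\<ge>M. unorm (X m - X n) < e / (2 * C)"
    "\<forall>m\<ge>N. \<forall>n\<ge>N. unorm (Y m - Y n) < e / (2 * B)"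
    using assms unfolding ga_Cauchy_def by meson
  have "unorm (X m * Y m - X n * Y n) < e" if "m \<ge> max M N" "n \<ge> max M N" for m n
  proof -
    have *: "unorm (X m - X n) < e / (2 * C)" "unorm (Y m - Y n) < e / (2 * B)" using MN that by auto
    have "unorm (X m) * unorm (Y m - Y n) \<le> B * unorm (Y m - Y n)"
      "unorm (X m - X n) * unorm (Y n) \<le> unorm (X m - X n) * C"
      using B C by (auto intro: mult_right_mono mult_left_mono)
    moreover have "B * unorm (Y m - Y n) < e / 2" "unorm (X m - X n) * C < e / 2"
      using * B C by (auto simp: field_simps)
    ultimately show ?thesis using unorm_mult_diff[of "X m" "Y m" "X n" "Y n"] by linarith
  qed
  then show "\<exists>N. \<forall>m\<ge>N. \<forall>n\<ge>N. unorm (X m * Y m - X n * Y n) < e" by blast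
qed

lemma unorm_convergent: "ga_Cauchy X \<Longrightarrow> convergent (\<lambda>n. unorm (X n))"
proof (rule Cauchy_convergent, rule metric_CauchyI)
  fix e :: real assume "ga_Cauchy X" "e > 0"
  then obtain N where "\<forall>m\<ge>N. \<forall>n\<ge>N. unorm (X m - X n) < e" unfolding ga_Cauchy_def by blast
  then show "\<exists>N. \<forall>m\<ge>N. \<forall>n\<ge>N. dist (unorm (X m)) (unorm (X n)) < e"
    unfolding dist_real_def using unorm_diff order.strict_trans1 by meson
qed

lemma ga_equivI:
  assumes "ga_Cauchy X" "ga_Cauchy Y" "\<And>n. unorm (X n - Y n) \<le> Z n" "Z \<longlonglongrightarrow> 0"
  shows "ga_equiv X Y"
  unfolding ga_equiv_def
  by (intro conjI assms(1,2) tendsto_sandwich[OF _ _ tendsto_const assms(4)])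
    (simp_all add: always_eventually assms(3))

instantiation group_cstar :: (group_add) "{real_normed_algebra_1, scaleC}"
begin

lift_definition zero_group_cstar :: "'a group_cstar" is "\<lambda>_. 0"
  by (simp add: ga_equiv_refl ga_Cauchy_const)

lift_definition one_group_cstar :: "'a group_cstar" is "\<lambda>_. 1"
  by (simp add: ga_equiv_refl ga_Cauchy_const)

lift_definition plus_group_cstar :: "'a group_cstar \<Rightarrow> 'a group_cstar \<Rightarrow> 'a group_cstar"
  is "\<lambda>X Y n. X n + Y n"
proof -
  fix X X' Y Y' :: "nat \<Rightarrow> ('a \<Rightarrow>\<^sub>0 complex)"
  assume *: "ga_equiv X X'" "ga_equiv Y Y'"
  show "ga_equiv (\<lambda>n. X n + Y n) (\<lambda>n. X' n + Y' n)"
  proof (rule ga_equivI)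
    show "unorm (X n + Y n - (X' n + Y' n)) \<le> unorm (X n - X' n) + unorm (Y n - Y' n)" for n
      using unorm_add[of "X n - X' n" "Y n - Y' n"] by (simp add: algebra_simps)
    show "(\<lambda>n. unorm (X n - X' n) + unorm (Y n - Y' n)) \<longlonglongrightarrow> 0"
      using * by (auto simp: ga_equiv_def intro: tendsto_add_zero)
  qed (use * in \<open>auto simp: ga_equiv_def intro: ga_Cauchy_add\<close>)
qed

lift_definition scaleC_group_cstar :: "complex \<Rightarrow> 'a group_cstar \<Rightarrow> 'a group_cstar"
  is "\<lambda>c X n. ga_scale c (X n)"
proof -
  fix c and X Y :: "nat \<Rightarrow> ('a \<Rightarrow>\<^sub>0 complex)"
  assume *: "ga_equiv X Y"
  show "ga_equiv (\<lambda>n. ga_scale c (X n)) (\<lambda>n. ga_scale c (Y n))"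
  proof (rule ga_equivI)
    show "(\<lambda>n. cmod c * unorm (X n - Y n)) \<longlonglongrightarrow> 0"
      using * by (auto simp: ga_equiv_def intro: tendsto_mult_right_zero)
  qed (use * in \<open>simp_all add: ga_equiv_def unorm_scale ga_Cauchy_scale flip: ga_scale_diff\<close>)
qed

lift_definition times_group_cstar :: "'a group_cstar \<Rightarrow> 'a group_cstar \<Rightarrow> 'a group_cstar"
  is "\<lambda>X Y n. X n * Y n"
proof -
  fix X X' Y Y' :: "nat \<Rightarrow> ('a \<Rightarrow>\<^sub>0 complex)"
  assume *: "ga_equiv X X'" "ga_equiv Y Y'"
  obtain B where B: "\<And>n. unorm (X n) \<le> B" using * ga_Cauchy_bounded unfolding ga_equiv_def by blast
  obtain C where C: "\<And>n. unorm (Y' n) \<le> C" using * ga_Cauchy_bounded unfolding ga_equiv_def by blast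
  show "ga_equiv (\<lambda>n. X n * Y n) (\<lambda>n. X' n * Y' n)"
  proof (rule ga_equivI)
    show "unorm (X n * Y n - X' n * Y' n) \<le> B * unorm (Y n - Y' n) + unorm (X n - X' n) * C" for n
      by (rule order_trans[OF unorm_mult_diff]) (intro add_mono mult_right_mono mult_left_mono B C unorm_nonneg)
    show "(\<lambda>n. B * unorm (Y n - Y' n) + unorm (X n - X' n) * C) \<longlonglongrightarrow> 0"
      using * by (auto simp: ga_equiv_def intro!: tendsto_add_zero tendsto_mult_right_zero tendsto_mult_left_zero)
  qed (use * in \<open>auto simp: ga_equiv_def intro: ga_Cauchy_mult\<close>)
qed

lift_definition norm_group_cstar :: "'a group_cstar \<Rightarrow> real" is "\<lambda>X. lim (\<lambda>n. unorm (X n))"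
proof -
  fix X Y :: "nat \<Rightarrow> ('a \<Rightarrow>\<^sub>0 complex)"
  assume *: "ga_equiv X Y"
  have "(\<lambda>n. unorm (X n) - unorm (Y n)) \<longlonglongrightarrow> 0"
    by (rule Lim_null_comparison[where g = "\<lambda>n. unorm (X n - Y n)"])
      (use * in \<open>auto simp: ga_equiv_def unorm_diff\<close>)
  moreover obtain l where l: "(\<lambda>n. unorm (Y n)) \<longlonglongrightarrow> l"
    using * unorm_convergent unfolding ga_equiv_def convergent_def by blast
  ultimately have "(\<lambda>n. unorm (X n)) \<longlonglongrightarrow> l"
    using tendsto_add[of _ 0 _ _ l] by fastforce
  with l show "lim (\<lambda>n. unorm (X n)) = lim (\<lambda>n. unorm (Y n))" by (simp add: limI)
qed

definition scaleR_group_cstar :: "real \<Rightarrow> 'a group_cstar \<Rightarrow> 'a group_cstar"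
  where "scaleR_group_cstar r a = complex_of_real r *\<^sub>C a"
definition uminus_group_cstar :: "'a group_cstar \<Rightarrow> 'a group_cstar"
  where "uminus_group_cstar a = (- 1) *\<^sub>C a"
definition minus_group_cstar :: "'a group_cstar \<Rightarrow> 'a group_cstar \<Rightarrow> 'a group_cstar"
  where "minus_group_cstar a b = a + (- 1) *\<^sub>C b"
definition dist_group_cstar :: "'a group_cstar \<Rightarrow> 'a group_cstar \<Rightarrow> real"
  where "dist_group_cstar a b = norm (a - b)"
definition sgn_group_cstar :: "'a group_cstar \<Rightarrow> 'a group_cstar"
  where "sgn_group_cstar a = inverse (norm a) *\<^sub>R a"
definition uniformity_group_cstar :: "('a group_cstar \<times> 'a group_cstar) filter"
  where "uniformity_group_cstar = (INF e\<in>{0 <..}. principal {(x, y). dist x y < e})"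
definition open_group_cstar :: "'a group_cstar set \<Rightarrow> bool"
  where "open_group_cstar U \<longleftrightarrow> (\<forall>x\<in>U. \<forall>\<^sub>F (x', y) in uniformity. x' = x \<longrightarrow> y \<in> U)"

lemma group_cstar_norm_lim:
  assumes "ga_Cauchy X"
  shows "(\<lambda>n. unorm (X n)) \<longlonglongrightarrow> norm (abs_group_cstar X)"
  using unorm_convergent[OF assms] ga_equiv_refl[OF assms]
  by (simp add: norm_group_cstar.abs_eq convergent_LIMSEQ_iff)

lemma group_cstar_cases:
  obtains X where "ga_Cauchy X" "a = abs_group_cstar X"
  using that[of "rep_group_cstar a"] Quotient3_abs_rep[OF Quotient3_group_cstar, of a]
    Quotient3_rep_reflp[OF Quotient3_group_cstar, of a] by (simp add: ga_equiv_def)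

instance
proof
  fix a b c :: "'a group_cstar" and r s :: real
  obtain X where X: "ga_Cauchy X" "a = abs_group_cstar X" by (rule group_cstar_cases)
  obtain Y where Y: "ga_Cauchy Y" "b = abs_group_cstar Y" by (rule group_cstar_cases)
  obtain Z where Z: "ga_Cauchy Z" "c = abs_group_cstar Z" by (rule group_cstar_cases)
  note s = plus_group_cstar.abs_eq times_group_cstar.abs_eq zero_group_cstar_def one_group_cstar_def
    scaleC_group_cstar.abs_eq ga_equiv_refl ga_Cauchy_const ga_Cauchy_add ga_Cauchy_mult ga_Cauchy_scale
    X Y Z scaleR_group_cstar_def uminus_group_cstar_def minus_group_cstar_def
  note sc = ga_scale_def mult_map_scale_conv_mult single_add mult_single algebra_simps
  show "a + b + c = a + (b + c)" by (simp add: s add.assoc)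
  show "a + b = b + a" by (simp add: s add.commute)
  show "0 + a = a" by (simp add: s)
  show "- a + a = 0" using ga_Cauchy_scale[OF X(1), of "- 1"] by (simp add: s flip: ga_uminus)
  show "a - b = a + - b" by (simp add: s)
  show "r *\<^sub>R (a + b) = r *\<^sub>R a + r *\<^sub>R b" by (simp add: s ga_scale_add)
  show "(r + s) *\<^sub>R a = r *\<^sub>R a + s *\<^sub>R a"
    by (simp add: s) (simp add: sc)
  show "r *\<^sub>R s *\<^sub>R a = (r * s) *\<^sub>R a"
    by (simp add: s) (simp add: sc flip: mult.assoc)
  show "1 *\<^sub>R a = a"
    by (simp add: s) (simp add: sc)
  show "a * b * c = a * (b * c)" by (simp add: s mult.assoc)
  show "(a + b) * c = a * c + b * c" by (simp add: s algebra_simps)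
  show "a * (b + c) = a * b + a * c" by (simp add: s algebra_simps)
  show "1 * a = a" "a * 1 = a" by (simp_all add: s)
  show "r *\<^sub>R a * b = r *\<^sub>R (a * b)" by (simp add: s ga_scale_mult)
  show "a * r *\<^sub>R b = r *\<^sub>R (a * b)" by (simp add: s ga_scale_mult_right)
  show "dist a b = norm (a - b)" by (rule dist_group_cstar_def)
  show "sgn a = inverse (norm a) *\<^sub>R a" by (rule sgn_group_cstar_def)
  show "uniformity = (INF e\<in>{0<..}. principal {(x :: 'a group_cstar, y). dist x y < e})"
    by (rule uniformity_group_cstar_def)
  show "open U = (\<forall>x\<in>U. \<forall>\<^sub>F (x', y) in uniformity. x' = x \<longrightarrow> y \<in> U)" for U :: "'a group_cstar set"
    by (rule open_group_cstar_def)
  have lims: "(\<lambda>n. unorm (X n)) \<longlonglongrightarrow> norm a" "(\<lambda>n. unorm (Y n)) \<longlonglongrightarrow> norm b"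
    using group_cstar_norm_lim X Y by auto
  show "norm (a + b) \<le> norm a + norm b"
  proof (rule LIMSEQ_le)
    show "(\<lambda>n. unorm (X n + Y n)) \<longlonglongrightarrow> norm (a + b)"
      using group_cstar_norm_lim[OF ga_Cauchy_add[OF X(1) Y(1)]] by (simp add: s)
    show "(\<lambda>n. unorm (X n) + unorm (Y n)) \<longlonglongrightarrow> norm a + norm b" by (intro tendsto_add lims)
  qed (auto intro: unorm_add)
  show "norm (a * b) \<le> norm a * norm b"
  proof (rule LIMSEQ_le)
    show "(\<lambda>n. unorm (X n * Y n)) \<longlonglongrightarrow> norm (a * b)"
      using group_cstar_norm_lim[OF ga_Cauchy_mult[OF X(1) Y(1)]] by (simp add: s)
    show "(\<lambda>n. unorm (X n) * unorm (Y n)) \<longlonglongrightarrow> norm a * norm b" by (intro tendsto_mult lims)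
  qed (auto intro: unorm_mult)
  show "norm (r *\<^sub>R a) = \<bar>r\<bar> * norm a"
  proof (rule LIMSEQ_unique)
    show "(\<lambda>n. unorm (ga_scale (complex_of_real r) (X n))) \<longlonglongrightarrow> norm (r *\<^sub>R a)"
      using group_cstar_norm_lim[OF ga_Cauchy_scale[OF X(1)]] by (simp add: s)
    show "(\<lambda>n. unorm (ga_scale (complex_of_real r) (X n))) \<longlonglongrightarrow> \<bar>r\<bar> * norm a"
      unfolding unorm_scale by (auto intro: tendsto_mult_left lims)
  qed
  have one: "(\<lambda>n. unorm (1 :: 'a \<Rightarrow>\<^sub>0 complex)) \<longlonglongrightarrow> norm (1 :: 'a group_cstar)"
    using group_cstar_norm_lim[OF ga_Cauchy_const] by (simp only: one_group_cstar_def)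
  then show n1: "norm (1 :: 'a group_cstar) = 1"
    by (simp add: LIMSEQ_const_iff)
  have n0: "norm (0 :: 'a group_cstar) = 0"
    using group_cstar_norm_lim[OF ga_Cauchy_const, of "0 :: 'a \<Rightarrow>\<^sub>0 complex"]
    by (simp add: zero_group_cstar_def LIMSEQ_const_iff)
  show "norm a = 0 \<longleftrightarrow> a = 0"
  proof
    assume "norm a = 0"
    then have "ga_equiv X (\<lambda>_. 0)" using lims(1) X by (simp add: ga_equiv_def ga_Cauchy_const)
    then show "a = 0" using X Quotient3_rel_abs[OF Quotient3_group_cstar] by (metis zero_group_cstar_def)
  qed (simp add: n0)
  show "(0 :: 'a group_cstar) \<noteq> 1" using n0 n1 by (metis zero_neq_one)
qed

end

instance group_cstar :: (group_add) complex_normed_vector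
proof
  fix c d :: complex and a b :: "'a group_cstar" and r :: real
  obtain X where X: "ga_Cauchy X" "a = abs_group_cstar X" by (rule group_cstar_cases)
  obtain Y where Y: "ga_Cauchy Y" "b = abs_group_cstar Y" by (rule group_cstar_cases)
  note s = plus_group_cstar.abs_eq scaleC_group_cstar.abs_eq ga_equiv_refl ga_Cauchy_scale ga_Cauchy_add X Y
  show "c *\<^sub>C (a + b) = c *\<^sub>C a + c *\<^sub>C b" by (simp add: s ga_scale_add)
  show "(c + d) *\<^sub>C a = c *\<^sub>C a + d *\<^sub>C a"
    by (simp add: s) (simp add: ga_scale_def mult_map_scale_conv_mult single_add algebra_simps)
  show "c *\<^sub>C d *\<^sub>C a = (c * d) *\<^sub>C a"
    by (simp add: s) (simp add: ga_scale_def mult_map_scale_conv_mult mult_single flip: mult.assoc)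
  show "r *\<^sub>R a = complex_of_real r *\<^sub>C a" by (rule scaleR_group_cstar_def)
  show "norm (c *\<^sub>C a) = cmod c * norm a"
  proof (rule LIMSEQ_unique)
    show "(\<lambda>n. unorm (ga_scale c (X n))) \<longlonglongrightarrow> norm (c *\<^sub>C a)"
      using group_cstar_norm_lim[OF ga_Cauchy_scale[OF X(1)]] by (simp add: s)
    show "(\<lambda>n. unorm (ga_scale c (X n))) \<longlonglongrightarrow> cmod c * norm a"
      unfolding unorm_scale X(2) by (intro tendsto_mult_left group_cstar_norm_lim X(1))
  qed
qed

definition of_ga :: "('g::group_add \<Rightarrow>\<^sub>0 complex) \<Rightarrow> 'g group_cstar"
  where "of_ga f = abs_group_cstar (\<lambda>_. f)"

lemma norm_of_ga [simp]: "norm (of_ga f) = unorm f"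
  using group_cstar_norm_lim[OF ga_Cauchy_const, of f] by (simp add: of_ga_def LIMSEQ_const_iff)

lemma of_ga_add: "of_ga (f + h) = of_ga f + of_ga h"
  by (simp add: of_ga_def plus_group_cstar.abs_eq ga_equiv_refl ga_Cauchy_const)

lemma of_ga_mult: "of_ga (f * h) = of_ga f * of_ga h"
  by (simp add: of_ga_def times_group_cstar.abs_eq ga_equiv_refl ga_Cauchy_const)

lemma of_ga_scale: "of_ga (ga_scale c f) = c *\<^sub>C of_ga f"
  by (simp add: of_ga_def scaleC_group_cstar.abs_eq ga_equiv_refl ga_Cauchy_const)

lemma group_cstar_scaleC_mult:
  "(c *\<^sub>C a) * b = c *\<^sub>C (a * b)" "a * (c *\<^sub>C b) = c *\<^sub>C (a * b)" for a b :: "'g::group_add group_cstar"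
proof -
  obtain X where X: "ga_Cauchy X" "a = abs_group_cstar X" by (rule group_cstar_cases)
  obtain Y where Y: "ga_Cauchy Y" "b = abs_group_cstar Y" by (rule group_cstar_cases)
  show "(c *\<^sub>C a) * b = c *\<^sub>C (a * b)" "a * (c *\<^sub>C b) = c *\<^sub>C (a * b)"
    by (simp_all add: X Y times_group_cstar.abs_eq scaleC_group_cstar.abs_eq ga_equiv_refl ga_Cauchy_mult
        ga_Cauchy_scale ga_scale_mult ga_scale_mult_right)
qed

lemma of_ga_diff: "of_ga (f - h) = of_ga f - of_ga h"
proof -
  have "of_ga (f - h) + of_ga h = of_ga f" by (simp flip: of_ga_add)
  then show ?thesis by (simp add: eq_diff_eq)
qed

lemma of_ga_tendsto:
  assumes "ga_Cauchy X"
  shows "(\<lambda>n. of_ga (X n)) \<longlonglongrightarrow> abs_group_cstar X"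
proof (rule LIMSEQ_I)
  fix e :: real assume "e > 0"
  then have "e / 2 > 0" by simp
  then obtain N where N: "\<forall>m\<ge>N. \<forall>n\<ge>N. unorm (X m - X n) < e / 2"
    using assms unfolding ga_Cauchy_def by blast
  have "norm (of_ga (X n) - abs_group_cstar X) < e" if "n \<ge> N" for n
  proof -
    have C: "ga_Cauchy (\<lambda>m. X n - X m)"
      by (rule ga_CauchyI[OF assms, where C = 1]) (simp add: unorm_minus_commute)
    have "abs_group_cstar (\<lambda>m. X n - X m) + abs_group_cstar X = of_ga (X n)"
      by (simp add: of_ga_def plus_group_cstar.abs_eq ga_equiv_refl C assms)
    then have eq: "of_ga (X n) - abs_group_cstar X = abs_group_cstar (\<lambda>m. X n - X m)"
      by (metis add_diff_cancel_right')
    have "norm (abs_group_cstar (\<lambda>m. X n - X m)) \<le> e / 2"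
      by (rule tendsto_upperbound[OF group_cstar_norm_lim[OF C]])
        (use N that in \<open>auto simp: eventually_sequentially less_imp_le intro!: exI[of _ N]\<close>)
    then show ?thesis using \<open>e > 0\<close> by (simp add: eq)
  qed
  then show "\<exists>N. \<forall>n\<ge>N. norm (of_ga (X n) - abs_group_cstar X) < e" by blast
qed

lemma of_ga_dense: "e > 0 \<Longrightarrow> \<exists>f. norm (a - of_ga f) < e"
proof -
  assume e: "e > 0"
  obtain X where X: "ga_Cauchy X" "a = abs_group_cstar X" by (rule group_cstar_cases)
  obtain n where "norm (of_ga (X n) - a) < e"
    using LIMSEQ_D[OF of_ga_tendsto[OF X(1)] e] X(2) by auto
  then show ?thesis by (auto simp: norm_minus_commute)
qed

instance group_cstar :: (group_add) banach
proof
  fix A :: "nat \<Rightarrow> 'a group_cstar"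
  assume A: "Cauchy A"
  have "\<forall>n. \<exists>f. norm (A n - of_ga f) < inverse (real (Suc n))"
    by (intro allI of_ga_dense) simp
  then obtain X where X: "\<And>n. norm (A n - of_ga (X n)) < inverse (real (Suc n))" by metis
  have null: "(\<lambda>n. of_ga (X n) - A n) \<longlonglongrightarrow> 0"
    by (rule Lim_null_comparison[OF _ LIMSEQ_inverse_real_of_nat])
      (use X in \<open>auto simp: norm_minus_commute less_imp_le\<close>)
  have "Cauchy (\<lambda>n. of_ga (X n))"
  proof (rule metric_CauchyI)
    fix e :: real assume "e > 0"
    then have "e / 3 > 0" by simp
    then obtain M N where M: "\<And>m n. m \<ge> M \<Longrightarrow> n \<ge> M \<Longrightarrow> norm (A m - A n) < e / 3"
      and N: "\<And>n. n \<ge> N \<Longrightarrow> norm (of_ga (X n) - A n) < e / 3"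
      using A LIMSEQ_D[OF null] unfolding Cauchy_def dist_norm by (metis diff_zero)
    have "dist (of_ga (X m)) (of_ga (X n)) < e" if "m \<ge> max M N" "n \<ge> max M N" for m n
    proof -
      have eq: "of_ga (X m) - of_ga (X n) = (of_ga (X m) - A m) + (A m - A n) - (of_ga (X n) - A n)"
        by simp
      have "norm (of_ga (X m) - of_ga (X n))
          \<le> norm (of_ga (X m) - A m) + norm (A m - A n) + norm (of_ga (X n) - A n)"
        unfolding eq
        using norm_triangle_ineq4[of "(of_ga (X m) - A m) + (A m - A n)" "of_ga (X n) - A n"]
          norm_triangle_ineq[of "of_ga (X m) - A m" "A m - A n"] by linarith
      also have "\<dots> < e" using M[of m n] N[of m] N[of n] that by simp
      finally show ?thesis by (simp add: dist_norm)
    qed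
    then show "\<exists>M. \<forall>m\<ge>M. \<forall>n\<ge>M. dist (of_ga (X m)) (of_ga (X n)) < e" by blast
  qed
  then have "ga_Cauchy X"
    by (simp add: Cauchy_def ga_Cauchy_def dist_norm flip: of_ga_diff)
  then have "(\<lambda>n. of_ga (X n) - (of_ga (X n) - A n)) \<longlonglongrightarrow> abs_group_cstar X - 0"
    by (intro tendsto_diff null of_ga_tendsto)
  then show "convergent A" by (auto simp: convergent_def)
qed

lift_definition cstar_star :: "'g::group_add group_cstar \<Rightarrow> 'g group_cstar" is "\<lambda>X n. ga_star (X n)"
proof -
  fix X Y :: "nat \<Rightarrow> ('g \<Rightarrow>\<^sub>0 complex)"
  assume *: "ga_equiv X Y"
  show "ga_equiv (\<lambda>n. ga_star (X n)) (\<lambda>n. ga_star (Y n))"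
  proof (rule ga_equivI)
    show "(\<lambda>n. unorm (X n - Y n)) \<longlonglongrightarrow> 0" using * by (simp add: ga_equiv_def)
  qed (use * in \<open>simp_all add: ga_equiv_def unorm_star ga_Cauchy_star flip: ga_star_diff\<close>)
qed

lemma of_ga_star: "cstar_star (of_ga f) = of_ga (ga_star f)"
  by (simp add: of_ga_def cstar_star.abs_eq ga_equiv_refl ga_Cauchy_const)

lemma norm_cstar_star_mult: "norm (cstar_star a * a) = (norm a)\<^sup>2"
proof -
  obtain X where X: "ga_Cauchy X" "a = abs_group_cstar X" by (rule group_cstar_cases)
  note C = ga_Cauchy_star[OF X(1)]
  have "(\<lambda>n. unorm (ga_star (X n) * X n)) \<longlonglongrightarrow> norm (cstar_star a * a)"
    using group_cstar_norm_lim[OF ga_Cauchy_mult[OF C X(1)]]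
    by (simp add: X(2) cstar_star.abs_eq times_group_cstar.abs_eq ga_equiv_refl X(1) C)
  moreover have "(\<lambda>n. unorm (ga_star (X n) * X n)) \<longlonglongrightarrow> (norm a)\<^sup>2"
    unfolding unorm_cstar X(2) by (intro tendsto_power group_cstar_norm_lim X(1))
  ultimately show ?thesis by (rule LIMSEQ_unique)
qed

definition group_elem :: "'g::group_add \<Rightarrow> 'g group_cstar"
  where "group_elem g = of_ga (Poly_Mapping.single g 1)"

section \<open>The reduced group C*-algebra\<close>

lemma square_summable_bij:
  assumes "bij s" "(\<lambda>x. (cmod (f x))\<^sup>2) summable_on UNIV"
  shows "(\<lambda>x. (cmod (f (s x)))\<^sup>2) summable_on UNIV"
  using summable_on_reindex_bij_betw[of s UNIV UNIV "\<lambda>x. (cmod (f x))\<^sup>2"] assms by auto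

lemma ell2_fun_bij_sums:
  assumes "bij s" "\<And>x. ell2_fun v' x = ell2_fun v (s x)" "\<And>x. ell2_fun w' x = ell2_fun w (s x)"
  shows "norm v' = norm v" "cinner v' w' = cinner v w"
  using infsum_reindex_bij_betw[of s UNIV UNIV "\<lambda>x. (cmod (ell2_fun v x))\<^sup>2"]
    infsum_reindex_bij_betw[of s UNIV UNIV "\<lambda>x. ell2_fun v x * cnj (ell2_fun w x)"] assms
  by (simp_all add: norm_ell2_def ell2_norm.rep_eq cinner.rep_eq)

lemma ell2_eqI: "(\<And>x. ell2_fun v x = ell2_fun w x) \<Longrightarrow> v = w"
  by (metis ell2_fun_inject ext)

lemma bij_left_translation: "bij (\<lambda>x :: 'g::group_add. - g + x)"
  by (rule bij_betw_byWitness[where f' = "\<lambda>x. g + x"]) (auto simp: add.assoc[symmetric])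

lift_definition left_translate :: "'g::group_add \<Rightarrow> 'g ell2 \<Rightarrow> 'g ell2" is "\<lambda>g f x. f (- g + x)"
  by (rule square_summable_bij[OF bij_left_translation])

lift_definition left_regular :: "'g::group_add \<Rightarrow> 'g ell2 \<Rightarrow>\<^sub>L 'g ell2" is left_translate
proof (rule bounded_linear_intro[where K = 1])
  fix g :: 'g and v w and r :: real
  show "left_translate g (v + w) = left_translate g v + left_translate g w"
    by (rule ell2_eqI) (simp add: left_translate.rep_eq plus_ell2.rep_eq)
  show "left_translate g (r *\<^sub>R v) = r *\<^sub>R left_translate g v"
    by (rule ell2_eqI) (simp add: left_translate.rep_eq scaleR_scaleC scaleC_ell2.rep_eq)
  show "norm (left_translate g v) \<le> norm v * 1"
    using ell2_fun_bij_sums(1)[OF bij_left_translation[of g], of "left_translate g v" v 0 0]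
    by (simp add: left_translate.rep_eq zero_ell2.rep_eq)
qed

lemma ell2_fun_left_regular: "ell2_fun (left_regular g v) x = ell2_fun v (- g + x)"
  by (simp add: left_regular.rep_eq left_translate.rep_eq)

lemma unitary_rep_left_regular: "unitary_rep (left_regular :: 'g::group_add \<Rightarrow> _)"
  unfolding unitary_rep_def
proof (intro conjI allI)
  show "left_regular (0 :: 'g) = id_blinfun"
    by (intro blinfun_eqI ell2_eqI) (simp add: ell2_fun_left_regular)
  show "left_regular (g + h) = left_regular g o\<^sub>L left_regular h" for g h :: 'g
    by (intro blinfun_eqI ell2_eqI) (simp add: ell2_fun_left_regular minus_add add.assoc del: add_uminus_conv_diff)
  show "left_regular g (c *\<^sub>C v) = c *\<^sub>C left_regular g v" for g :: 'g and c v
    by (rule ell2_eqI) (simp add: ell2_fun_left_regular scaleC_ell2.rep_eq)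
  show "cinner (left_regular g v) (left_regular g w) = cinner v w" for g :: 'g and v w
    by (rule ell2_fun_bij_sums(2)[OF bij_left_translation[of g]]) (simp_all add: ell2_fun_left_regular)
qed

context
begin

lemma bij_left_translation': "bij (\<lambda>x :: 'g::group_add \<times> nat. (- g + fst x, snd x))"
  by (rule bij_betw_byWitness[where f' = "\<lambda>x. (g + fst x, snd x)"]) (auto simp: add.assoc[symmetric])

private lift_definition amp_translate :: "'g::group_add \<Rightarrow> ('g \<times> nat) ell2 \<Rightarrow> ('g \<times> nat) ell2"
  is "\<lambda>g f x. f (- g + fst x, snd x)"
  by (rule square_summable_bij[OF bij_left_translation'])

private lift_definition amp_regular :: "'g::group_add \<Rightarrow> ('g \<times> nat) ell2 \<Rightarrow>\<^sub>L ('g \<times> nat) ell2"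
  is amp_translate
proof (rule bounded_linear_intro[where K = 1])
  fix g :: 'g and v w and r :: real
  show "amp_translate g (v + w) = amp_translate g v + amp_translate g w"
    by (rule ell2_eqI) (simp add: amp_translate.rep_eq plus_ell2.rep_eq)
  show "amp_translate g (r *\<^sub>R v) = r *\<^sub>R amp_translate g v"
    by (rule ell2_eqI) (simp add: amp_translate.rep_eq scaleR_scaleC scaleC_ell2.rep_eq)
  show "norm (amp_translate g v) \<le> norm v * 1"
    using ell2_fun_bij_sums(1)[OF bij_left_translation'[of g], of "amp_translate g v" v 0 0]
    by (simp add: amp_translate.rep_eq zero_ell2.rep_eq)
qed

private lemma ell2_fun_amp_regular: "ell2_fun (amp_regular g v) x = ell2_fun v (- g + fst x, snd x)"
  by (simp add: amp_regular.rep_eq amp_translate.rep_eq)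

private lemma unitary_rep_amp_regular: "unitary_rep (amp_regular :: 'g::group_add \<Rightarrow> _)"
  unfolding unitary_rep_def
proof (intro conjI allI)
  show "amp_regular (0 :: 'g) = id_blinfun"
    by (intro blinfun_eqI ell2_eqI) (simp add: ell2_fun_amp_regular)
  show "amp_regular (g + h) = amp_regular g o\<^sub>L amp_regular h" for g h :: 'g
    by (intro blinfun_eqI ell2_eqI) (simp add: ell2_fun_amp_regular minus_add add.assoc del: add_uminus_conv_diff)
  show "amp_regular g (c *\<^sub>C v) = c *\<^sub>C amp_regular g v" for g :: 'g and c v
    by (rule ell2_eqI) (simp add: ell2_fun_amp_regular scaleC_ell2.rep_eq)
  show "cinner (amp_regular g v) (amp_regular g w) = cinner v w" for g :: 'g and v w
    by (rule ell2_fun_bij_sums(2)[OF bij_left_translation'[of g]]) (simp_all add: ell2_fun_amp_regular)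
qed

private lemma ell2_amp_sum:
  assumes "((\<lambda>x. (cmod (f x))\<^sup>2) has_sum S) UNIV"
  shows "((\<lambda>x. (cmod (if snd x = (0::nat) then f (fst x) else 0))\<^sup>2) has_sum S) UNIV"
proof -
  have "inj (\<lambda>x :: 'a. (x, 0::nat))" by (rule injI) simp
  with assms have "((\<lambda>x. (cmod (if snd x = (0::nat) then f (fst x) else 0))\<^sup>2) has_sum S)
      (range (\<lambda>x. (x, 0)))"
    by (subst has_sum_reindex) (auto simp: o_def)
  then show ?thesis
    by (rule has_sum_cong_neutral[THEN iffD1, rotated -1]) (auto simp: image_iff split: if_splits prod.splits)
qed

private lift_definition ell2_amp :: "'a ell2 \<Rightarrow> ('a \<times> nat) ell2"
  is "\<lambda>f x. if snd x = 0 then f (fst x) else 0"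
  using ell2_amp_sum unfolding summable_on_def by blast

private lemma norm_ell2_amp: "norm (ell2_amp v) = norm v"
proof -
  have "((\<lambda>x. (cmod (ell2_fun v x))\<^sup>2) has_sum (\<Sum>\<^sub>\<infinity>x. (cmod (ell2_fun v x))\<^sup>2)) UNIV"
    using ell2_fun[of v] by simp
  from infsumI[OF ell2_amp_sum[OF this]] show ?thesis
    by (simp add: norm_ell2_def ell2_norm.rep_eq ell2_amp.rep_eq)
qed

lemma rep_ext_left_regular_le: "norm (rep_ext left_regular f) \<le> unorm f"
proof (rule norm_blinfun_bound)
  fix v :: "'a ell2"
  have fun_sum: "ell2_fun (sum F A) x = (\<Sum>i\<in>A. ell2_fun (F i) x)" for F :: "'a \<Rightarrow> 'x ell2" and A x
    by (induction A rule: infinite_finite_induct) (auto simp: plus_ell2.rep_eq zero_ell2.rep_eq)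
  have "ell2_amp (rep_ext left_regular f v) = rep_ext amp_regular f (ell2_amp v)"
    by (rule ell2_eqI) (simp add: rep_ext_def blinfun.sum_left fun_sum ell2_amp.rep_eq blinfun_apply_scaleC
        scaleC_ell2.rep_eq ell2_fun_left_regular ell2_fun_amp_regular)
  then have "norm (rep_ext left_regular f v) = norm (rep_ext amp_regular f (ell2_amp v))"
    by (simp add: norm_ell2_amp flip: norm_ell2_amp[of "rep_ext left_regular f v"])
  also have "\<dots> \<le> norm (rep_ext amp_regular f) * norm (ell2_amp v)" by (rule norm_blinfun)
  also have "\<dots> \<le> unorm f * norm v"
    unfolding norm_ell2_amp by (intro mult_right_mono rep_ext_le_unorm unitary_rep_amp_regular) simp
  finally show "norm (rep_ext left_regular f v) \<le> unorm f * norm v" .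
qed simp

end

lemma rep_ext_left_regular_convergent: "ga_Cauchy X \<Longrightarrow> convergent (\<lambda>n. rep_ext left_regular (X n))"
proof (rule Cauchy_convergent, rule metric_CauchyI)
  fix e :: real assume "ga_Cauchy X" "e > 0"
  then obtain N where N: "\<forall>m\<ge>N. \<forall>n\<ge>N. unorm (X m - X n) < e" unfolding ga_Cauchy_def by blast
  have "dist (rep_ext left_regular (X m)) (rep_ext left_regular (X n)) < e" if "m \<ge> N" "n \<ge> N" for m n
    using order.strict_trans1[OF rep_ext_left_regular_le[of "X m - X n"]] N that
    by (simp add: dist_norm rep_ext_diff)
  then show "\<exists>N. \<forall>m\<ge>N. \<forall>n\<ge>N. dist (rep_ext left_regular (X m)) (rep_ext left_regular (X n)) < e" by blast
qed

lift_definition regular_rep :: "'g::group_add group_cstar \<Rightarrow> 'g ell2 \<Rightarrow>\<^sub>L 'g ell2"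
  is "\<lambda>X. lim (\<lambda>n. rep_ext left_regular (X n))"
proof -
  fix X Y :: "nat \<Rightarrow> ('g \<Rightarrow>\<^sub>0 complex)"
  assume *: "ga_equiv X Y"
  obtain l where l: "(\<lambda>n. rep_ext left_regular (Y n)) \<longlonglongrightarrow> l"
    using * rep_ext_left_regular_convergent unfolding ga_equiv_def convergent_def by blast
  have "(\<lambda>n. rep_ext left_regular (X n - Y n)) \<longlonglongrightarrow> 0"
    by (rule Lim_null_comparison[where g = "\<lambda>n. unorm (X n - Y n)"])
      (use * in \<open>auto simp: ga_equiv_def rep_ext_left_regular_le\<close>)
  from tendsto_add[OF this l] have "(\<lambda>n. rep_ext left_regular (X n)) \<longlonglongrightarrow> l"
    by (simp add: rep_ext_diff)
  with l show "lim (\<lambda>n. rep_ext left_regular (X n)) = lim (\<lambda>n. rep_ext left_regular (Y n))"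
    by (simp add: limI)
qed

lemma regular_rep_of_ga: "regular_rep (of_ga f) = rep_ext left_regular f"
  unfolding of_ga_def
  by (subst regular_rep.abs_eq) (auto simp: ga_equiv_refl ga_Cauchy_const intro: limI)

definition reduced_cstar :: "('g::group_add ell2 \<Rightarrow>\<^sub>L 'g ell2) set"
  where "reduced_cstar = closure (range (rep_ext left_regular))"

section \<open>The Fourier-Stieltjes algebra\<close>

definition cstar_dual :: "('g::group_add group_cstar \<Rightarrow> complex) set"
  where "cstar_dual = {\<phi>. bounded_linear \<phi> \<and> (\<forall>c a. \<phi> (c *\<^sub>C a) = c * \<phi> a)}"

text \<open>
  The Fourier-Stieltjes algebra consists of the functions on the group obtained by restricting
  bounded functionals on the full group C*-algebra; \<open>fs_functional\<close> is the inverse of this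
  restriction map and expresses the identification of the algebra with the dual space.
\<close>

definition fourier_stieltjes :: "('g::group_add \<Rightarrow> complex) set"
  where "fourier_stieltjes = (\<lambda>\<phi> g. \<phi> (group_elem g)) ` cstar_dual"

definition fs_functional :: "('g::group_add \<Rightarrow> complex) \<Rightarrow> 'g group_cstar \<Rightarrow> complex"
  where "fs_functional f = (THE \<phi>. \<phi> \<in> cstar_dual \<and> (\<forall>g. \<phi> (group_elem g) = f g))"

lemma cstar_dual_eqI:
  assumes "\<phi> \<in> cstar_dual" "\<psi> \<in> cstar_dual" "\<And>g. \<phi> (group_elem g) = \<psi> (group_elem g)"
  shows "\<phi> = (\<psi> :: 'a::group_add group_cstar \<Rightarrow> complex)"
proof
  fix a :: "'a group_cstar"
  interpret \<phi>: bounded_linear \<phi> using assms(1) by (simp add: cstar_dual_def)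
  interpret \<psi>: bounded_linear \<psi> using assms(2) by (simp add: cstar_dual_def)
  have of_ga_sum: "of_ga (sum F A) = (\<Sum>x\<in>A. of_ga (F x))" for F and A :: "'a set"
  proof (induction A rule: infinite_finite_induct)
    case (insert x B)
    then show ?case by (simp add: of_ga_add)
  qed (use of_ga_diff[of 0 0] in simp_all)
  have "of_ga (Poly_Mapping.single g c) = c *\<^sub>C group_elem g" for g :: 'a and c
  proof -
    have "Poly_Mapping.single g c = ga_scale c (Poly_Mapping.single g 1)"
      by (rule poly_mapping_eqI) (simp add: lookup_single when_def)
    then show ?thesis by (simp add: group_elem_def of_ga_scale)
  qed
  then have "of_ga f = (\<Sum>g\<in>Poly_Mapping.keys f. Poly_Mapping.lookup f g *\<^sub>C group_elem g)" for f :: "'a \<Rightarrow>\<^sub>0 complex"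
    by (subst ga_single_sum) (simp add: of_ga_sum)
  then have eq: "\<phi> (of_ga f) = \<psi> (of_ga f)" for f
    using assms by (simp add: \<phi>.sum \<psi>.sum cstar_dual_def)
  obtain X where X: "ga_Cauchy X" "a = abs_group_cstar X" by (rule group_cstar_cases)
  have "(\<lambda>n. \<phi> (of_ga (X n))) \<longlonglongrightarrow> \<phi> a" "(\<lambda>n. \<psi> (of_ga (X n))) \<longlonglongrightarrow> \<psi> a"
    unfolding X(2) by (intro \<phi>.tendsto \<psi>.tendsto of_ga_tendsto X(1))+
  then show "\<phi> a = \<psi> a" unfolding eq by (rule LIMSEQ_unique)
qed

lemma fs_functional:
  assumes "f \<in> fourier_stieltjes"
  shows "fs_functional f \<in> cstar_dual" "fs_functional f (group_elem g) = f g"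
proof -
  obtain \<phi> where \<phi>: "\<phi> \<in> cstar_dual" "\<And>g. \<phi> (group_elem g) = f g"
    using assms by (auto simp: fourier_stieltjes_def)
  have "\<exists>!\<phi>. \<phi> \<in> cstar_dual \<and> (\<forall>g. \<phi> (group_elem g) = f g)"
    by (rule ex1I[of _ \<phi>]) (use \<phi> cstar_dual_eqI in \<open>auto intro!: cstar_dual_eqI\<close>)
  from theI'[OF this] show "fs_functional f \<in> cstar_dual" "fs_functional f (group_elem g) = f g"
    by (auto simp: fs_functional_def)
qed

text \<open>
  The weak*-topology of the dual, transported to functions on the group; \<^term>\<open>euclidean\<close> on the
  function space is the product topology, that is, pointwise convergence on the C*-algebra.
\<close>

definition weak_star_topology :: "('g::group_add \<Rightarrow> complex) topology"
  where "weak_star_topology = pullback_topology fourier_stieltjes fs_functional euclidean"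

definition linear_subspace :: "('g \<Rightarrow> complex) set \<Rightarrow> bool" where
  "linear_subspace E \<longleftrightarrow> (\<lambda>_. 0) \<in> E \<and> (\<forall>f\<in>E. \<forall>h\<in>E. (\<lambda>g. f g + h g) \<in> E) \<and>
    (\<forall>c. \<forall>f\<in>E. (\<lambda>g. c * f g) \<in> E)"

definition G_invariant :: "('g::group_add \<Rightarrow> complex) set \<Rightarrow> bool" where
  "G_invariant E \<longleftrightarrow> (\<forall>f\<in>E. \<forall>x. (\<lambda>y. f (y + x)) \<in> E \<and> (\<lambda>y. f (x + y)) \<in> E)"

definition canonical_trace :: "'g::group_add \<Rightarrow> complex"
  where "canonical_trace = indicator {0}"

definition reduced_fourier_stieltjes :: "('g::group_add \<Rightarrow> complex) set" where
  "reduced_fourier_stieltjes =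
    {f \<in> fourier_stieltjes. \<forall>a. regular_rep a = 0 \<longrightarrow> fs_functional f a = 0}"

section \<open>The quotient C*-algebra\<close>

definition preannihilator :: "('g::group_add \<Rightarrow> complex) set \<Rightarrow> 'g group_cstar set"
  where "preannihilator E = {a. \<forall>f\<in>E. fs_functional f a = 0}"

definition quot_map :: "('g::group_add \<Rightarrow> complex) set \<Rightarrow> 'g group_cstar \<Rightarrow> 'g group_cstar set"
  where "quot_map E a = {b. b - a \<in> preannihilator E}"

definition quot_cstar :: "('g::group_add \<Rightarrow> complex) set \<Rightarrow> 'g group_cstar set set"
  where "quot_cstar E = range (quot_map E)"

lemma preannihilator_closed:
  assumes "E \<subseteq> fourier_stieltjes"
  shows "0 \<in> preannihilator E"
    and "a \<in> preannihilator E \<Longrightarrow> b \<in> preannihilator E \<Longrightarrow> a + b \<in> preannihilator E"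
    and "a \<in> preannihilator E \<Longrightarrow> c *\<^sub>C a \<in> preannihilator E"
    and "a \<in> preannihilator E \<Longrightarrow> b \<in> preannihilator E \<Longrightarrow> a - b \<in> preannihilator E"
proof -
  have lin: "bounded_linear (fs_functional f)" "fs_functional f (c *\<^sub>C a) = c * fs_functional f a"
    if "f \<in> E" for f c a
    using fs_functional(1)[of f] assms that by (auto simp: cstar_dual_def)
  note add = bounded_linear.linear[THEN linear_add, OF lin(1)]
  note diff = bounded_linear.linear[THEN linear_diff, OF lin(1)]
  note zero = bounded_linear.linear[THEN linear_0, OF lin(1)]
  show "0 \<in> preannihilator E"
    and "a \<in> preannihilator E \<Longrightarrow> b \<in> preannihilator E \<Longrightarrow> a + b \<in> preannihilator E"
    and "a \<in> preannihilator E \<Longrightarrow> c *\<^sub>C a \<in> preannihilator E"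
    and "a \<in> preannihilator E \<Longrightarrow> b \<in> preannihilator E \<Longrightarrow> a - b \<in> preannihilator E"
    by (auto simp: preannihilator_def add diff zero lin(2))
qed

lemma preannihilator_ideal:
  assumes E: "E \<subseteq> fourier_stieltjes" "G_invariant E" and a: "a \<in> preannihilator E"
  shows "a * b \<in> preannihilator E" "b * a \<in> preannihilator E"
proof -
  have *: "fs_functional f (a * b) = 0 \<and> fs_functional f (b * a) = 0" if f: "f \<in> E" for f
  proof -
    have fs: "f \<in> fourier_stieltjes" using E f by auto
    have D: "fs_functional f \<in> cstar_dual" by (rule fs_functional(1)[OF fs])
    interpret bounded_linear "fs_functional f" using D by (simp add: cstar_dual_def)
    have mult_elem: "group_elem g * group_elem h = group_elem (g + h)" for g h :: 'a
      by (simp add: group_elem_def mult_single flip: of_ga_mult)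
    have dual: "(\<lambda>p. fs_functional f (p * q)) \<in> cstar_dual" "(\<lambda>p. fs_functional f (q * p)) \<in> cstar_dual" for q
      using D bounded_linear_compose[OF bounded_linear_axioms bounded_linear_mult_left]
        bounded_linear_compose[OF bounded_linear_axioms bounded_linear_mult_right]
      by (auto simp: cstar_dual_def group_cstar_scaleC_mult)
    have zero: "(\<lambda>_. 0) \<in> cstar_dual" by (simp add: cstar_dual_def bounded_linear_zero)
    have translates: "(\<lambda>y. f (y + x)) \<in> E" "(\<lambda>y. f (x + y)) \<in> E" for x
      using E(2) f by (auto simp: G_invariant_def)
    then have fs_translates: "(\<lambda>y. f (y + x)) \<in> fourier_stieltjes" "(\<lambda>y. f (x + y)) \<in> fourier_stieltjes" for x
      using E(1) by auto
    have "(\<lambda>p. fs_functional f (p * group_elem x)) = fs_functional (\<lambda>y. f (y + x))" for x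
      by (rule cstar_dual_eqI[OF dual(1) fs_functional(1)])
        (simp_all add: fs_translates mult_elem fs_functional(2) fs)
    then have 1: "fs_functional f (a * group_elem x) = 0" for x
      using a translates by (auto simp: preannihilator_def fun_eq_iff)
    have "(\<lambda>p. fs_functional f (group_elem x * p)) = fs_functional (\<lambda>y. f (x + y))" for x
      by (rule cstar_dual_eqI[OF dual(2) fs_functional(1)])
        (simp_all add: fs_translates mult_elem fs_functional(2) fs)
    then have 2: "fs_functional f (group_elem x * a) = 0" for x
      using a translates by (auto simp: preannihilator_def fun_eq_iff)
    have "(\<lambda>q. fs_functional f (a * q)) = (\<lambda>_. 0)" "(\<lambda>q. fs_functional f (q * a)) = (\<lambda>_. 0)"
      by (rule cstar_dual_eqI[OF dual(2) zero] cstar_dual_eqI[OF dual(1) zero], simp add: 1 2)+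
    then show ?thesis by (simp add: fun_eq_iff)
  qed
  then show "a * b \<in> preannihilator E" "b * a \<in> preannihilator E"
    by (auto simp: preannihilator_def)
qed

lemma quot_map_eq_iff:
  assumes "E \<subseteq> fourier_stieltjes"
  shows "quot_map E a = quot_map E b \<longleftrightarrow> a - b \<in> preannihilator E"
proof
  assume "quot_map E a = quot_map E b"
  moreover have "a \<in> quot_map E a" by (simp add: quot_map_def preannihilator_closed(1)[OF assms])
  ultimately show "a - b \<in> preannihilator E" by (simp add: quot_map_def)
next
  assume ab: "a - b \<in> preannihilator E"
  have "c - a \<in> preannihilator E \<longleftrightarrow> c - b \<in> preannihilator E" for c
    using preannihilator_closed(2)[OF assms ab, of "c - a"]
      preannihilator_closed(4)[OF assms _ ab, of "c - b"] by (auto simp: algebra_simps)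
  then show "quot_map E a = quot_map E b" by (auto simp: quot_map_def)
qed

lemma quot_map_refl: "E \<subseteq> fourier_stieltjes \<Longrightarrow> a \<in> quot_map E a"
  by (simp add: quot_map_def preannihilator_closed(1))

text \<open>
  The operations on cosets are computed on representatives. They do not depend on the choice,
  because the preannihilator is a closed two-sided ideal and such ideals of a C*-algebra are
  self-adjoint.
\<close>

definition quot_rep :: "'g::group_add group_cstar set \<Rightarrow> 'g group_cstar"
  where "quot_rep X = (SOME a. a \<in> X)"

definition quot_add :: "('g::group_add \<Rightarrow> complex) set \<Rightarrow>
    'g group_cstar set \<Rightarrow> 'g group_cstar set \<Rightarrow> 'g group_cstar set"
  where "quot_add E X Y = quot_map E (quot_rep X + quot_rep Y)"

definition quot_scale :: "('g::group_add \<Rightarrow> complex) set \<Rightarrow>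
    complex \<Rightarrow> 'g group_cstar set \<Rightarrow> 'g group_cstar set"
  where "quot_scale E c X = quot_map E (c *\<^sub>C quot_rep X)"

definition quot_mult :: "('g::group_add \<Rightarrow> complex) set \<Rightarrow>
    'g group_cstar set \<Rightarrow> 'g group_cstar set \<Rightarrow> 'g group_cstar set"
  where "quot_mult E X Y = quot_map E (quot_rep X * quot_rep Y)"

definition quot_star :: "('g::group_add \<Rightarrow> complex) set \<Rightarrow> 'g group_cstar set \<Rightarrow> 'g group_cstar set"
  where "quot_star E X = quot_map E (cstar_star (quot_rep X))"

definition quot_norm :: "'g::group_add group_cstar set \<Rightarrow> real"
  where "quot_norm X = Inf (norm ` X)"

lemma quot_rep_quot_map:
  assumes "E \<subseteq> fourier_stieltjes"
  shows "quot_rep (quot_map E a) - a \<in> preannihilator E"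
proof -
  have "quot_rep (quot_map E a) \<in> quot_map E a"
    unfolding quot_rep_def by (rule someI[of _ a]) (rule quot_map_refl[OF assms])
  then show ?thesis by (simp add: quot_map_def)
qed

lemma quot_ops:
  assumes E: "E \<subseteq> fourier_stieltjes"
  shows "quot_add E (quot_map E a) (quot_map E b) = quot_map E (a + b)"
    and "quot_scale E c (quot_map E a) = quot_map E (c *\<^sub>C a)"
    and "G_invariant E \<Longrightarrow> quot_mult E (quot_map E a) (quot_map E b) = quot_map E (a * b)"
proof -
  let ?a = "quot_rep (quot_map E a)" and ?b = "quot_rep (quot_map E b)"
  note ab = quot_rep_quot_map[OF E, of a] quot_rep_quot_map[OF E, of b]
  note cl = preannihilator_closed[OF E]
  have "?a + ?b - (a + b) = (?a - a) + (?b - b)" by simp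
  with ab cl(2) show "quot_add E (quot_map E a) (quot_map E b) = quot_map E (a + b)"
    unfolding quot_add_def quot_map_eq_iff[OF E] by metis
  have "c *\<^sub>C ?a - c *\<^sub>C a = c *\<^sub>C (?a - a)"
    using scaleC_add_right[of c "?a - a" a] by simp
  with ab cl(3) show "quot_scale E c (quot_map E a) = quot_map E (c *\<^sub>C a)"
    unfolding quot_scale_def quot_map_eq_iff[OF E] by metis
  assume G: "G_invariant E"
  have "?a * ?b - a * b = (?a - a) * ?b + a * (?b - b)" by (simp add: algebra_simps)
  with ab cl(2) preannihilator_ideal[OF E G]
  show "quot_mult E (quot_map E a) (quot_map E b) = quot_map E (a * b)"
    unfolding quot_mult_def quot_map_eq_iff[OF E] by metis
qed

definition quot_dual :: "('g::group_add \<Rightarrow> complex) set \<Rightarrow> ('g group_cstar set \<Rightarrow> complex) set" where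
  "quot_dual E = {\<omega>.
    (\<forall>X\<in>quot_cstar E. \<forall>Y\<in>quot_cstar E. \<omega> (quot_add E X Y) = \<omega> X + \<omega> Y) \<and>
    (\<forall>c. \<forall>X\<in>quot_cstar E. \<omega> (quot_scale E c X) = c * \<omega> X) \<and>
    (\<exists>K. \<forall>X\<in>quot_cstar E. cmod (\<omega> X) \<le> K * quot_norm X)}"

text \<open>
  The *-homomorphisms into the reduced group C*-algebra. They are taken extensional, so that
  equality of maps on the quotient is equality in the logic.
\<close>

definition quot_hom :: "('g::group_add \<Rightarrow> complex) set \<Rightarrow>
    ('g group_cstar set \<Rightarrow> 'g ell2 \<Rightarrow>\<^sub>L 'g ell2) set" where
  "quot_hom E = {\<rho> \<in> quot_cstar E \<rightarrow>\<^sub>E reduced_cstar.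
    (\<forall>X\<in>quot_cstar E. \<forall>Y\<in>quot_cstar E. \<rho> (quot_add E X Y) = \<rho> X + \<rho> Y) \<and>
    (\<forall>c. \<forall>X\<in>quot_cstar E. \<rho> (quot_scale E c X) = c *\<^sub>C \<rho> X) \<and>
    (\<forall>X\<in>quot_cstar E. \<forall>Y\<in>quot_cstar E. \<rho> (quot_mult E X Y) = \<rho> X o\<^sub>L \<rho> Y) \<and>
    (\<forall>X\<in>quot_cstar E. is_adjoint (\<rho> X) (\<rho> (quot_star E X)))}"

text \<open>
  Of the equivalent conditions defining a group C*-algebra, this is containment of the
  preannihilator in the kernel of the regular representation.
\<close>

definition is_group_cstar :: "('g::group_add \<Rightarrow> complex) set \<Rightarrow> bool"
  where "is_group_cstar E \<longleftrightarrow> preannihilator E \<subseteq> {a. regular_rep a = 0}"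

end

theory Submission
  imports Defs
begin

text \<open>
  Write \<open>P\<close> for the preannihilator of \<open>E\<close> and \<open>\<lambda>\<close> for the regular representation; the first
  condition says that \<open>P\<close> lies in the kernel of \<open>\<lambda>\<close>. The passage from \<open>P\<close> back to \<open>E\<close> is the
  bipolar theorem for weak*-closed subspaces: a functional that vanishes on \<open>P\<close> belongs to \<open>E\<close>
  (\<open>mem_if_vanishes_on_preannihilator\<close>). A basic weak*-open set constrains a functional at finitely
  many points only, so this reduces to interpolating a functional at finitely many points by
  members of a linear space (\<open>interpolation_by_linear_space\<close>). If \<open>P\<close> lies in the kernel of
  \<open>\<lambda>\<close>, then every element of the reduced Fourier-Stieltjes algebra vanishes on \<open>P\<close>, so it lies in
  \<open>E\<close>; and the canonical trace is such an element, since
  \<open>tr a = \<langle>\<lambda>(a) \<delta>\<^sub>e, \<delta>\<^sub>e\<rangle>\<close>.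

  Suppose conversely that the trace vanishes on \<open>P\<close>, as it does when it belongs to \<open>E\<close>. Since \<open>P\<close>
  is a two-sided ideal, \<open>tr (g a h) = 0\<close> for \<open>a\<close> in \<open>P\<close> and group elements \<open>g\<close>, \<open>h\<close>. This number
  is the matrix coefficient \<open>\<langle>\<lambda>(a) \<delta>\<^sub>h, \<delta>\<^sub>k\<rangle>\<close> with \<open>k\<close> the inverse of \<open>g\<close>, so all matrix
  coefficients of \<open>\<lambda>(a)\<close> vanish and \<open>\<lambda>(a) = 0\<close> (\<open>is_group_cstar_if_trace_vanishes\<close>).

  A functional on the quotient that is \<open>1\<close> at the identity and \<open>0\<close> at the other group elements
  pulls back to a functional on the full C*-algebra that agrees with the trace on the group, hence
  everywhere; factoring through the quotient, the trace then vanishes on \<open>P\<close>. In the other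
  direction the trace descends to the quotient once it belongs to \<open>E\<close>. Finally, \<open>\<lambda>\<close> factors
  through the quotient exactly when it vanishes on \<open>P\<close>, and the factor is unique because the
  quotient map is surjective.
\<close>

section \<open>The regular representation on the full group C*-algebra\<close>

lemma regular_rep_tendsto:
  assumes "ga_Cauchy X"
  shows "(\<lambda>n. rep_ext left_regular (X n)) \<longlonglongrightarrow> regular_rep (abs_group_cstar X)"
  using rep_ext_left_regular_convergent[OF assms]
  by (simp add: regular_rep.abs_eq ga_equiv_refl assms convergent_LIMSEQ_iff)

lemma regular_rep_add: "regular_rep (a + b) = regular_rep a + regular_rep b"
proof -
  obtain X where X: "ga_Cauchy X" "a = abs_group_cstar X" by (rule group_cstar_cases)
  obtain Y where Y: "ga_Cauchy Y" "b = abs_group_cstar Y" by (rule group_cstar_cases)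
  have "(\<lambda>n. rep_ext left_regular (X n + Y n)) \<longlonglongrightarrow> regular_rep (a + b)"
    using regular_rep_tendsto[OF ga_Cauchy_add[OF X(1) Y(1)]]
    by (simp add: X Y plus_group_cstar.abs_eq ga_equiv_refl)
  moreover have "(\<lambda>n. rep_ext left_regular (X n + Y n)) \<longlonglongrightarrow> regular_rep a + regular_rep b"
    unfolding rep_ext_add X(2) Y(2) by (intro tendsto_add regular_rep_tendsto X Y)
  ultimately show ?thesis by (rule LIMSEQ_unique)
qed

lemma tendsto_scaleC:
  fixes f :: "nat \<Rightarrow> 'a :: complex_normed_vector"
  assumes "f \<longlonglongrightarrow> l"
  shows "(\<lambda>n. c *\<^sub>C f n) \<longlonglongrightarrow> c *\<^sub>C l"
proof -
  have "bounded_linear (\<lambda>x :: 'a. c *\<^sub>C x)"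
    by (rule bounded_linear_intro[where K = "cmod c"])
      (simp_all add: scaleC_add_right scaleR_scaleC scaleC_scaleC norm_scaleC mult.commute)
  then show ?thesis by (rule bounded_linear.tendsto[OF _ assms])
qed

lemma regular_rep_scaleC: "regular_rep (c *\<^sub>C a) = c *\<^sub>C regular_rep a"
proof -
  obtain X where X: "ga_Cauchy X" "a = abs_group_cstar X" by (rule group_cstar_cases)
  have "(\<lambda>n. rep_ext left_regular (ga_scale c (X n))) \<longlonglongrightarrow> regular_rep (c *\<^sub>C a)"
    using regular_rep_tendsto[OF ga_Cauchy_scale[OF X(1)]]
    by (simp add: X scaleC_group_cstar.abs_eq ga_equiv_refl)
  moreover have "(\<lambda>n. rep_ext left_regular (ga_scale c (X n))) \<longlonglongrightarrow> c *\<^sub>C regular_rep a"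
    unfolding rep_ext_scale X(2) by (intro tendsto_scaleC regular_rep_tendsto X)
  ultimately show ?thesis by (rule LIMSEQ_unique)
qed

lemma regular_rep_mult: "regular_rep (a * b) = regular_rep a o\<^sub>L regular_rep b"
proof -
  obtain X where X: "ga_Cauchy X" "a = abs_group_cstar X" by (rule group_cstar_cases)
  obtain Y where Y: "ga_Cauchy Y" "b = abs_group_cstar Y" by (rule group_cstar_cases)
  have "(\<lambda>n. rep_ext left_regular (X n * Y n)) \<longlonglongrightarrow> regular_rep (a * b)"
    using regular_rep_tendsto[OF ga_Cauchy_mult[OF X(1) Y(1)]]
    by (simp add: X Y times_group_cstar.abs_eq ga_equiv_refl)
  moreover have "(\<lambda>n. rep_ext left_regular (X n * Y n)) \<longlonglongrightarrow> (regular_rep a o\<^sub>L regular_rep b)"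
    unfolding rep_ext_mult[OF unitary_rep_left_regular] X(2) Y(2)
    by (intro bounded_bilinear.tendsto[OF bounded_bilinear_blinfun_compose] regular_rep_tendsto X Y)
  ultimately show ?thesis by (rule LIMSEQ_unique)
qed

lemma norm_regular_rep_le: "norm (regular_rep a) \<le> norm a"
proof -
  obtain X where X: "ga_Cauchy X" "a = abs_group_cstar X" by (rule group_cstar_cases)
  show ?thesis
    unfolding X(2)
    by (rule LIMSEQ_le[OF tendsto_norm[OF regular_rep_tendsto[OF X(1)]] group_cstar_norm_lim[OF X(1)]])
      (auto simp: rep_ext_left_regular_le)
qed

lemma bounded_linear_regular_rep: "bounded_linear regular_rep"
  by (rule bounded_linear_intro[where K = 1])
    (simp_all add: regular_rep_add regular_rep_scaleC scaleR_scaleC norm_regular_rep_le)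

lemma regular_rep_zero: "regular_rep 0 = 0"
  by (rule linear_0[OF bounded_linear.linear[OF bounded_linear_regular_rep]])

lemma regular_rep_diff: "regular_rep (a - b) = regular_rep a - regular_rep b"
  by (rule linear_diff[OF bounded_linear.linear[OF bounded_linear_regular_rep]])

lemma regular_rep_in_reduced_cstar: "regular_rep a \<in> reduced_cstar"
proof -
  obtain X where X: "ga_Cauchy X" "a = abs_group_cstar X" by (rule group_cstar_cases)
  show ?thesis
    unfolding reduced_cstar_def closure_sequential X(2)
    by (rule exI, rule conjI[OF _ regular_rep_tendsto[OF X(1)]]) auto
qed

lemma bounded_linear_cinner_left: "bounded_linear (\<lambda>v. cinner v w)"
  by (rule bounded_linear_intro[where K = "norm w"])
    (simp_all add: cinner_add_left scaleR_scaleC cinner_scaleC_left scaleR_conv_of_real cinner_summable(2))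

lemma bounded_linear_cinner_right: "bounded_linear (\<lambda>w. cinner v w)"
  by (rule bounded_linear_intro[where K = "norm v"])
    (simp_all add: cinner_add_right scaleR_scaleC cinner_scaleC_right scaleR_conv_of_real
      cinner_summable(2) mult.commute[of _ "norm v"])

lemma regular_rep_star: "is_adjoint (regular_rep a) (regular_rep (cstar_star a))"
  unfolding is_adjoint_def
proof (intro allI)
  fix v w
  obtain X where X: "ga_Cauchy X" "a = abs_group_cstar X" by (rule group_cstar_cases)
  have apply_lim: "(\<lambda>n. blinfun_apply (S n) u) \<longlonglongrightarrow> T u" if "S \<longlonglongrightarrow> T" for S u and T :: "'a ell2 \<Rightarrow>\<^sub>L 'a ell2"
    using that by (intro blinfun.tendsto tendsto_const)
  have "(\<lambda>n. cinner (rep_ext left_regular (X n) v) w) \<longlonglongrightarrow> cinner (regular_rep a v) w"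
    unfolding X(2) by (intro bounded_linear.tendsto[OF bounded_linear_cinner_left] apply_lim regular_rep_tendsto X)
  moreover have "cinner (rep_ext left_regular (X n) v) w
      = cinner v (rep_ext left_regular (ga_star (X n)) w)" for n
    using rep_ext_star[OF unitary_rep_left_regular, of "X n"] by (simp add: is_adjoint_def)
  moreover have "(\<lambda>n. cinner v (rep_ext left_regular (ga_star (X n)) w))
      \<longlonglongrightarrow> cinner v (regular_rep (cstar_star a) w)"
    using regular_rep_tendsto[OF ga_Cauchy_star[OF X(1)]]
    by (intro bounded_linear.tendsto[OF bounded_linear_cinner_right] apply_lim)
      (simp add: X cstar_star.abs_eq ga_equiv_refl)
  ultimately show "cinner (regular_rep a v) w = cinner v (regular_rep (cstar_star a) w)"
    using LIMSEQ_unique by simp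
qed

lemma regular_rep_group_elem: "regular_rep (group_elem g) = left_regular g"
  by (simp add: group_elem_def regular_rep_of_ga rep_ext_single)

section \<open>The canonical trace\<close>

lift_definition ell2_delta :: "'a \<Rightarrow> 'a ell2" is "\<lambda>y x. if x = y then 1 else 0"
  by (rule finite_nonzero_values_imp_summable_on) simp

lemma cinner_ell2_delta: "cinner v (ell2_delta y) = ell2_fun v y"
proof -
  have "cinner v (ell2_delta y) = (\<Sum>\<^sub>\<infinity>x\<in>{y}. ell2_fun v x)"
    unfolding cinner.rep_eq ell2_delta.rep_eq by (rule infsum_cong_neutral) auto
  then show ?thesis by simp
qed

lemma left_regular_delta: "left_regular g (ell2_delta h) = ell2_delta (g + h)"
proof (rule ell2_eqI)
  fix x
  have "- g + x = h \<longleftrightarrow> x = g + h" by (metis add.assoc add_0 left_minus right_minus)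
  then show "ell2_fun (left_regular g (ell2_delta h)) x = ell2_fun (ell2_delta (g + h)) x"
    by (simp add: ell2_fun_left_regular ell2_delta.rep_eq)
qed

lemma canonical_trace_fourier_stieltjes:
  shows "canonical_trace \<in> (fourier_stieltjes :: ('g::group_add \<Rightarrow> complex) set)"
    and "fs_functional canonical_trace a = cinner (regular_rep a (ell2_delta (0 :: 'g))) (ell2_delta 0)"
proof -
  let ?\<tau> = "\<lambda>a. cinner (regular_rep a (ell2_delta (0 :: 'g))) (ell2_delta 0)"
  have "bounded_linear ?\<tau>"
    by (intro bounded_linear_compose[OF bounded_linear_cinner_left]
        bounded_linear_compose[OF blinfun.bounded_linear_left] bounded_linear_regular_rep)
  then have dual: "?\<tau> \<in> cstar_dual"
    by (simp add: cstar_dual_def regular_rep_scaleC blinfun_apply_scaleC cinner_scaleC_left)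
  have val: "?\<tau> (group_elem g) = canonical_trace g" for g
    by (simp add: regular_rep_group_elem left_regular_delta cinner_ell2_delta ell2_delta.rep_eq
        canonical_trace_def indicator_def)
  show mem: "canonical_trace \<in> (fourier_stieltjes :: ('g \<Rightarrow> complex) set)"
    unfolding fourier_stieltjes_def by (rule image_eqI[OF _ dual]) (simp add: val fun_eq_iff)
  have "fs_functional canonical_trace = ?\<tau>"
    by (rule cstar_dual_eqI[OF fs_functional(1)[OF mem] dual]) (simp add: val fs_functional(2)[OF mem])
  then show "fs_functional canonical_trace a = ?\<tau> a" by simp
qed

lemma canonical_trace_reduced: "canonical_trace \<in> reduced_fourier_stieltjes"
  by (auto simp: reduced_fourier_stieltjes_def canonical_trace_fourier_stieltjes)

text \<open>
  Translating by group elements on both sides turns the trace, which is the coefficient of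
  \<open>\<lambda>(a)\<close> at the identity, into an arbitrary coefficient.
\<close>

lemma canonical_trace_translate:
  "fs_functional canonical_trace (group_elem g * a * group_elem h) = ell2_fun (regular_rep a (ell2_delta h)) (- g)"
  by (simp add: canonical_trace_fourier_stieltjes regular_rep_mult regular_rep_group_elem
      left_regular_delta cinner_ell2_delta ell2_fun_left_regular)

lemma regular_rep_eq_zeroI:
  assumes "\<And>x y. ell2_fun (regular_rep a (ell2_delta y)) x = 0"
  shows "regular_rep a = 0"
proof (intro blinfun_eqI ell2_eqI)
  fix v x
  note adj = regular_rep_star[of a, unfolded is_adjoint_def, rule_format]
  have zero: "regular_rep a (ell2_delta y) = 0" for y
    by (rule ell2_eqI) (simp add: assms zero_ell2.rep_eq)
  \<comment> \<open>The adjoint of \<open>\<lambda>(a)\<close> also kills the basis vectors, and the entries of \<open>\<lambda>(a) v\<close> are the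
    inner products of \<open>v\<close> with their images. This settles arbitrary \<open>v\<close> at once.\<close>
  have "cinner (ell2_delta y) (regular_rep (cstar_star a) (ell2_delta x)) = 0" for y
    using adj[of "ell2_delta y" "ell2_delta x"] by (simp add: zero)
  moreover have "cinner (ell2_delta y) u = cnj (ell2_fun u y)" for y and u :: "'a ell2"
  proof -
    have "cinner (ell2_delta y) u = (\<Sum>\<^sub>\<infinity>x\<in>{y}. cnj (ell2_fun u x))"
      unfolding cinner.rep_eq ell2_delta.rep_eq by (rule infsum_cong_neutral) auto
    then show ?thesis by simp
  qed
  ultimately have "regular_rep (cstar_star a) (ell2_delta x) = 0"
    by (intro ell2_eqI) (simp add: zero_ell2.rep_eq)
  then show "ell2_fun (regular_rep a v) x = ell2_fun (blinfun_apply 0 v) x"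
    using adj[of v "ell2_delta x"] by (simp add: cinner_ell2_delta zero_ell2.rep_eq)
qed

lemma is_group_cstar_if_trace_vanishes:
  assumes "E \<subseteq> fourier_stieltjes" "G_invariant E"
    and "\<And>a. a \<in> preannihilator E \<Longrightarrow> fs_functional canonical_trace a = 0"
  shows "is_group_cstar E"
  unfolding is_group_cstar_def
proof (intro subsetI CollectI regular_rep_eq_zeroI)
  fix a x y
  assume "a \<in> preannihilator E"
  then have "fs_functional canonical_trace (group_elem (- x) * a * group_elem y) = 0"
    by (intro assms(3) preannihilator_ideal[OF assms(1,2)])
  then show "ell2_fun (regular_rep a (ell2_delta y)) x = 0"
    by (simp add: canonical_trace_translate)
qed

section \<open>Weak*-closed subspaces are annihilators\<close>

text \<open>
  The values at \<open>A\<close> of the members of \<open>F\<close> form a subspace of a finite-dimensional space, and a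
  subspace is cut out by the linear relations that hold on it. The induction eliminates one point
  at a time, as in Gaussian elimination.
\<close>

lemma interpolation_by_linear_space:
  assumes "finite A" "linear_subspace F"
    and "\<And>c. (\<And>\<psi>. \<psi> \<in> F \<Longrightarrow> (\<Sum>a\<in>A. c a * \<psi> a) = 0) \<Longrightarrow> (\<Sum>a\<in>A. c a * \<phi> a) = 0"
  shows "\<exists>\<psi>\<in>F. \<forall>a\<in>A. \<psi> a = \<phi> a"
  using assms
proof (induction A arbitrary: F \<phi> rule: finite_induct)
  case empty
  then show ?case by (auto simp: linear_subspace_def)
next
  case (insert b A)
  have upd: "(\<Sum>a\<in>A. (c(b := d)) a * f a) = (\<Sum>a\<in>A. c a * f a)" for c f and d :: complex
    by (rule sum.cong) (use insert.hyps in auto)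
  have add: "(\<lambda>g. f g + h g) \<in> F" and scale: "(\<lambda>g. c * f g) \<in> F" if "f \<in> F" "h \<in> F" for f h c
    using insert.prems(1) that by (auto simp: linear_subspace_def)
  show ?case
  proof (cases "\<forall>\<psi>\<in>F. \<psi> b = 0")
    case True
    have "\<phi> b = 0"
      using insert.prems(2)[of "(\<lambda>_. 0)(b := 1)"] insert.hyps True unfolding sum.insert[OF insert.hyps] upd
      by simp
    moreover have "\<exists>\<psi>\<in>F. \<forall>a\<in>A. \<psi> a = \<phi> a"
    proof (rule insert.IH[OF insert.prems(1)])
      fix c assume "\<And>\<psi>. \<psi> \<in> F \<Longrightarrow> (\<Sum>a\<in>A. c a * \<psi> a) = 0"
      then show "(\<Sum>a\<in>A. c a * \<phi> a) = 0"
        using insert.prems(2)[of "c(b := 0)"] unfolding sum.insert[OF insert.hyps] upd by simp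
    qed
    ultimately show ?thesis using True by auto
  next
    case False
    then obtain \<psi>\<^sub>1 where \<psi>\<^sub>1: "\<psi>\<^sub>1 \<in> F" "\<psi>\<^sub>1 b \<noteq> 0" by blast
    define \<psi>\<^sub>0 where "\<psi>\<^sub>0 = (\<lambda>a. inverse (\<psi>\<^sub>1 b) * \<psi>\<^sub>1 a)"
    have \<psi>\<^sub>0: "\<psi>\<^sub>0 \<in> F" "\<psi>\<^sub>0 b = 1" unfolding \<psi>\<^sub>0_def using scale[OF \<psi>\<^sub>1(1) \<psi>\<^sub>1(1)] \<psi>\<^sub>1 by auto
    let ?F = "{\<psi>\<in>F. \<psi> b = 0}"
    have "\<exists>\<psi>\<in>?F. \<forall>a\<in>A. \<psi> a = \<phi> a + (- \<phi> b) * \<psi>\<^sub>0 a"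
    proof (rule insert.IH)
      show "linear_subspace ?F" using insert.prems(1) by (auto simp: linear_subspace_def)
      fix c assume c: "\<And>\<psi>. \<psi> \<in> ?F \<Longrightarrow> (\<Sum>a\<in>A. c a * \<psi> a) = 0"
      \<comment> \<open>A relation on the members vanishing at \<open>b\<close> extends to one on all of \<open>F\<close>: the coefficient
        at \<open>b\<close> is the one that makes the relation hold for \<open>\<psi>\<^sub>0\<close>, which spans a complement of those members.\<close>
      let ?d = "- (\<Sum>a\<in>A. c a * \<psi>\<^sub>0 a)"
      have comb: "(\<Sum>a\<in>A. c a * (\<psi> a + (- \<psi> b) * \<psi>\<^sub>0 a)) = (\<Sum>a\<in>insert b A. (c(b := ?d)) a * \<psi> a)" for \<psi>
        unfolding sum.insert[OF insert.hyps] upd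
        by (simp add: distrib_left sum.distrib sum_distrib_left sum_distrib_right sum_negf sum_subtractf algebra_simps)
      show "(\<Sum>a\<in>A. c a * (\<phi> a + (- \<phi> b) * \<psi>\<^sub>0 a)) = 0"
        unfolding comb
      proof (rule insert.prems(2))
        fix \<psi> assume \<psi>: "\<psi> \<in> F"
        then have "(\<lambda>a. \<psi> a + (- \<psi> b) * \<psi>\<^sub>0 a) \<in> ?F"
          using add[OF \<psi> scale[OF \<psi>\<^sub>0(1) \<psi>\<^sub>0(1), of "- \<psi> b"]] \<psi>\<^sub>0(2) by simp
        from c[OF this] show "(\<Sum>a\<in>insert b A. (c(b := ?d)) a * \<psi> a) = 0" unfolding comb .
      qed
    qed
    then obtain \<psi> where \<psi>: "\<psi> \<in> F" "\<psi> b = 0" "\<And>a. a \<in> A \<Longrightarrow> \<psi> a = \<phi> a + (- \<phi> b) * \<psi>\<^sub>0 a" by auto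
    show ?thesis
      by (rule bexI[OF _ add[OF \<psi>(1) scale[OF \<psi>\<^sub>0(1) \<psi>\<^sub>0(1)], of "\<phi> b"]]) (auto simp: \<psi> \<psi>\<^sub>0)
  qed
qed

lemma open_fun_finite_determination:
  fixes U :: "('a \<Rightarrow> 'b::topological_space) set"
  assumes "open U" "\<phi> \<in> U"
  obtains A where "finite A" "\<And>\<psi>. (\<And>a. a \<in> A \<Longrightarrow> \<psi> a = \<phi> a) \<Longrightarrow> \<psi> \<in> U"
proof -
  have "openin (product_topology (\<lambda>_. euclidean) UNIV) U" using assms(1) by (simp add: open_fun_def)
  from product_topology_open_contains_basis[OF this assms(2)]
  obtain X where X: "\<phi> \<in> (\<Pi>\<^sub>E i\<in>UNIV. X i)" "finite {i. X i \<noteq> topspace (euclidean :: 'b topology)}"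
    "(\<Pi>\<^sub>E i\<in>UNIV. X i) \<subseteq> U" by blast
  show ?thesis
  proof (rule that[OF X(2)])
    fix \<psi> assume \<psi>: "\<And>a. a \<in> {i. X i \<noteq> topspace euclidean} \<Longrightarrow> \<psi> a = \<phi> a"
    have "\<psi> i \<in> X i" for i using \<psi>[of i] X(1) by (cases "X i = UNIV") (auto simp: PiE_iff)
    then show "\<psi> \<in> U" using X(3) by (auto simp: PiE_iff)
  qed
qed

lemma fs_functional_eqI:
  assumes "f \<in> fourier_stieltjes" "\<phi> \<in> cstar_dual" "\<And>g. \<phi> (group_elem g) = f g"
  shows "fs_functional f = \<phi>"
  by (rule cstar_dual_eqI) (use assms in \<open>simp_all add: fs_functional\<close>)

lemma linear_subspace_fs_functional:
  fixes E :: "('g::group_add \<Rightarrow> complex) set"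
  assumes E: "E \<subseteq> fourier_stieltjes" "linear_subspace E"
  shows "linear_subspace (fs_functional ` E)"
proof -
  have D: "bounded_linear (fs_functional f)" "fs_functional f (c *\<^sub>C a) = c * fs_functional f a"
    "fs_functional f (group_elem g) = f g"
    if "f \<in> E" for f c a g
    using fs_functional[of f] E(1) that by (auto simp: cstar_dual_def)
  have "(\<lambda>_. 0) \<in> fs_functional ` E"
  proof (rule image_eqI)
    show 0: "(\<lambda>_. 0) \<in> E" using E(2) by (simp add: linear_subspace_def)
    show "(\<lambda>_. 0) = fs_functional (\<lambda>_ :: 'g. 0)"
      by (rule fs_functional_eqI[symmetric]) (use 0 E(1) in \<open>auto simp: cstar_dual_def bounded_linear_zero\<close>)
  qed
  moreover have "(\<lambda>a. fs_functional f a + fs_functional h a) \<in> fs_functional ` E"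
    if fh: "f \<in> E" "h \<in> E" for f h
  proof (rule image_eqI)
    show 0: "(\<lambda>g. f g + h g) \<in> E" using E(2) fh by (simp add: linear_subspace_def)
    show "(\<lambda>a. fs_functional f a + fs_functional h a) = fs_functional (\<lambda>g. f g + h g)"
      by (rule fs_functional_eqI[symmetric])
        (use 0 E(1) fh in \<open>auto simp: cstar_dual_def bounded_linear_add D distrib_left\<close>)
  qed
  moreover have "(\<lambda>a. c * fs_functional f a) \<in> fs_functional ` E" if f: "f \<in> E" for f c
  proof (rule image_eqI)
    show 0: "(\<lambda>g. c * f g) \<in> E" using E(2) f by (simp add: linear_subspace_def)
    show "(\<lambda>a. c * fs_functional f a) = fs_functional (\<lambda>g. c * f g)"
      by (rule fs_functional_eqI[symmetric])
        (use 0 E(1) f in \<open>auto simp: cstar_dual_def D bounded_linear_const_mult\<close>)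
  qed
  ultimately show ?thesis unfolding linear_subspace_def by auto
qed

lemma cstar_dual_sum:
  assumes "\<phi> \<in> cstar_dual"
  shows "\<phi> (\<Sum>a\<in>A. c a *\<^sub>C f a) = (\<Sum>a\<in>A. c a * \<phi> (f a))"
  using assms by (simp add: cstar_dual_def linear_sum bounded_linear.linear)

text \<open>
  The bipolar theorem. Near an element outside \<open>E\<close> a weak*-neighbourhood given by finitely many
  points of the C*-algebra misses \<open>E\<close>; interpolation at these points would produce a member of
  \<open>E\<close> inside it. The relations required for the interpolation are elements of the preannihilator.
\<close>

lemma mem_if_vanishes_on_preannihilator:
  fixes E :: "('g::group_add \<Rightarrow> complex) set"
  assumes E: "E \<subseteq> fourier_stieltjes" "linear_subspace E" "closedin weak_star_topology E"
    and f: "f \<in> fourier_stieltjes" "\<And>a. a \<in> preannihilator E \<Longrightarrow> fs_functional f a = 0"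
  shows "f \<in> E"
proof (rule ccontr)
  assume "f \<notin> E"
  have "topspace weak_star_topology = (fourier_stieltjes :: ('g \<Rightarrow> complex) set)"
    by (simp add: weak_star_topology_def topspace_pullback_topology)
  with E(3) obtain U where U: "open U" "fourier_stieltjes - E = fs_functional -` U \<inter> fourier_stieltjes"
    by (auto simp: closedin_def weak_star_topology_def openin_pullback_topology)
  with f(1) \<open>f \<notin> E\<close> have "fs_functional f \<in> U" by blast
  from open_fun_finite_determination[OF U(1) this]
  obtain A where A: "finite A" "\<And>\<psi>. (\<And>a. a \<in> A \<Longrightarrow> \<psi> a = fs_functional f a) \<Longrightarrow> \<psi> \<in> U" by blast
  have "\<exists>\<psi>\<in>fs_functional ` E. \<forall>a\<in>A. \<psi> a = fs_functional f a"
  proof (rule interpolation_by_linear_space[OF A(1) linear_subspace_fs_functional[OF E(1,2)]])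
    fix c assume c: "\<And>\<psi>. \<psi> \<in> fs_functional ` E \<Longrightarrow> (\<Sum>a\<in>A. c a * \<psi> a) = 0"
    have "(\<Sum>a\<in>A. c a *\<^sub>C a) \<in> preannihilator E"
      unfolding preannihilator_def
    proof (intro CollectI ballI)
      fix h assume h: "h \<in> E"
      then have "fs_functional h \<in> cstar_dual" using E(1) fs_functional(1) by auto
      then show "fs_functional h (\<Sum>a\<in>A. c a *\<^sub>C a) = 0"
        using c[of "fs_functional h"] h by (simp add: cstar_dual_sum[where f = "\<lambda>a. a"])
    qed
    from f(2)[OF this] show "(\<Sum>a\<in>A. c a * fs_functional f a) = 0"
      by (simp add: cstar_dual_sum[where f = "\<lambda>a. a"] fs_functional(1)[OF f(1)])
  qed
  then obtain h where "h \<in> E" "fs_functional h \<in> U" using A(2) by auto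
  then show False using U(2) E(1) by blast
qed

section \<open>Functionals and homomorphisms on the quotient\<close>

lemma quot_norm_le:
  assumes "E \<subseteq> fourier_stieltjes"
  shows "quot_norm (quot_map E a) \<le> norm a" "0 \<le> quot_norm (quot_map E a)"
proof -
  have a: "a \<in> quot_map E a" by (rule quot_map_refl[OF assms])
  then show "quot_norm (quot_map E a) \<le> norm a"
    unfolding quot_norm_def by (intro cInf_lower) (auto intro: bdd_belowI[of _ 0])
  show "0 \<le> quot_norm (quot_map E a)"
    unfolding quot_norm_def by (rule cInf_greatest) (use a in auto)
qed

lemma quot_dual_pullback:
  assumes E: "E \<subseteq> fourier_stieltjes" and \<omega>: "\<omega> \<in> quot_dual E"
  shows "(\<lambda>a. \<omega> (quot_map E a)) \<in> cstar_dual"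
proof -
  have mem: "quot_map E a \<in> quot_cstar E" for a by (simp add: quot_cstar_def)
  obtain K where K: "\<And>X. X \<in> quot_cstar E \<Longrightarrow> cmod (\<omega> X) \<le> K * quot_norm X"
    using \<omega> unfolding quot_dual_def by blast
  have add: "\<omega> (quot_map E (a + b)) = \<omega> (quot_map E a) + \<omega> (quot_map E b)"
    and scale: "\<omega> (quot_map E (c *\<^sub>C a)) = c * \<omega> (quot_map E a)" for a b c
    using \<omega> mem by (simp_all add: quot_dual_def flip: quot_ops[OF E])
  have bound: "cmod (\<omega> (quot_map E a)) \<le> norm a * \<bar>K\<bar>" for a
  proof -
    note n = quot_norm_le[OF E, of a]
    have "K * quot_norm (quot_map E a) \<le> \<bar>K\<bar> * norm a"
      by (rule mult_mono) (use n in auto)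
    then show ?thesis using K[OF mem[of a]] by (simp add: mult.commute)
  qed
  have "bounded_linear (\<lambda>a. \<omega> (quot_map E a))"
    by (rule bounded_linear_intro[where K = "\<bar>K\<bar>"])
      (simp_all add: add scale scaleR_scaleC bound scaleR_conv_of_real)
  then show ?thesis by (simp add: cstar_dual_def scale)
qed

lemma functional_descends:
  assumes E: "E \<subseteq> fourier_stieltjes" and f: "f \<in> E"
  shows "fs_functional f (quot_rep (quot_map E a)) = fs_functional f a"
proof -
  have "bounded_linear (fs_functional f)" using fs_functional(1)[of f] E f by (auto simp: cstar_dual_def)
  from linear_diff[OF bounded_linear.linear[OF this], of "quot_rep (quot_map E a)" a] show ?thesis
    using quot_rep_quot_map[OF E, of a] f by (simp add: preannihilator_def)
qed

text \<open>
  All members of a coset have the same value under a functional from \<open>E\<close>, so the bound by the norm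
  holds for each of them and hence for the infimum, which is the quotient norm.
\<close>

lemma quot_dual_descent:
  assumes E: "E \<subseteq> fourier_stieltjes" and f: "f \<in> E"
  shows "(\<lambda>X. fs_functional f (quot_rep X)) \<in> quot_dual E"
proof -
  have D: "fs_functional f \<in> cstar_dual" using fs_functional(1)[of f] E f by auto
  interpret bounded_linear "fs_functional f" using D by (simp add: cstar_dual_def)
  obtain K where K: "K > 0" "\<And>a. norm (fs_functional f a) \<le> norm a * K" using pos_bounded by blast
  have "cmod (fs_functional f a) \<le> K * quot_norm (quot_map E a)" for a
  proof -
    have "cmod (fs_functional f a) / K \<le> quot_norm (quot_map E a)"
      unfolding quot_norm_def
    proof (rule cInf_greatest)
      show "norm ` quot_map E a \<noteq> {}" using quot_map_refl[OF E, of a] by auto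
      fix r assume "r \<in> norm ` quot_map E a"
      then obtain b where b: "r = norm b" "b - a \<in> preannihilator E" by (auto simp: quot_map_def)
      then have "fs_functional f b = fs_functional f a" using f diff[of b a] by (simp add: preannihilator_def)
      with K(2)[of b] show "cmod (fs_functional f a) / K \<le> r"
        using K(1) b(1) by (simp add: divide_le_eq)
    qed
    then show ?thesis using K(1) by (simp add: divide_le_eq mult.commute)
  qed
  then show ?thesis
    using D unfolding quot_dual_def quot_cstar_def
    by (auto simp: quot_ops[OF E] functional_descends[OF E f] add cstar_dual_def intro!: exI[of _ K])
qed

lemma is_group_cstar_if_quot_functional:
  fixes E :: "('g::group_add \<Rightarrow> complex) set"
  assumes E: "E \<subseteq> fourier_stieltjes" "G_invariant E"
    and \<omega>: "\<omega> \<in> quot_dual E" "\<And>x::'g. \<omega> (quot_map E (group_elem x)) = (if x = 0 then 1 else 0)"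
  shows "is_group_cstar E"
proof (rule is_group_cstar_if_trace_vanishes[OF E])
  fix a assume a: "a \<in> preannihilator E"
  note dual = quot_dual_pullback[OF E(1) \<omega>(1)]
  have tr: "fs_functional canonical_trace = (\<lambda>a. \<omega> (quot_map E a))"
    by (rule fs_functional_eqI[OF canonical_trace_fourier_stieltjes(1) dual])
      (simp add: \<omega>(2) canonical_trace_def indicator_def)
  have "quot_map E a = quot_map E 0" using a by (simp add: quot_map_eq_iff[OF E(1)])
  moreover have "\<omega> (quot_map E 0) = 0"
    using dual linear_0[OF bounded_linear.linear] by (fastforce simp: cstar_dual_def)
  ultimately show "fs_functional canonical_trace a = 0" by (simp add: tr)
qed

text \<open>
  The factor is the regular representation of a chosen representative. The involution of a coset is
  computed on the same representative, so the factor respects it.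
\<close>

lemma regular_rep_factors_iff:
  assumes E: "E \<subseteq> fourier_stieltjes" "G_invariant E"
  shows "is_group_cstar E \<longleftrightarrow> (\<exists>!\<rho>. \<rho> \<in> quot_hom E \<and> (\<forall>a. \<rho> (quot_map E a) = regular_rep a))"
proof
  assume P: "is_group_cstar E"
  define \<rho> where "\<rho> = restrict (\<lambda>X. regular_rep (quot_rep X)) (quot_cstar E)"
  have \<rho>: "\<rho> (quot_map E a) = regular_rep a" for a
    using P quot_rep_quot_map[OF E(1), of a] regular_rep_diff[of "quot_rep (quot_map E a)" a]
    by (auto simp: \<rho>_def quot_cstar_def is_group_cstar_def)
  have star: "is_adjoint (\<rho> X) (\<rho> (quot_star E X))" if "X \<in> quot_cstar E" for X
    using that by (simp add: quot_star_def \<rho> regular_rep_star) (simp add: \<rho>_def regular_rep_star)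
  have hom: "\<rho> \<in> quot_hom E"
    unfolding quot_hom_def
  proof (intro CollectI conjI)
    show "\<rho> \<in> quot_cstar E \<rightarrow>\<^sub>E reduced_cstar"
      by (auto simp: \<rho>_def regular_rep_in_reduced_cstar)
  qed (use star in \<open>auto simp: quot_cstar_def quot_ops[OF E(1)] E(2) \<rho> regular_rep_add
      regular_rep_scaleC regular_rep_mult\<close>)
  show "\<exists>!\<rho>. \<rho> \<in> quot_hom E \<and> (\<forall>a. \<rho> (quot_map E a) = regular_rep a)"
  proof (rule ex1I[of _ \<rho>])
    fix \<sigma> assume \<sigma>: "\<sigma> \<in> quot_hom E \<and> (\<forall>a. \<sigma> (quot_map E a) = regular_rep a)"
    show "\<sigma> = \<rho>"
      by (rule PiE_ext[of _ "quot_cstar E" "\<lambda>_. reduced_cstar"])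
        (use \<sigma> hom \<rho> in \<open>auto simp: quot_hom_def quot_cstar_def\<close>)
  qed (use hom \<rho> in auto)
next
  assume "\<exists>!\<rho>. \<rho> \<in> quot_hom E \<and> (\<forall>a. \<rho> (quot_map E a) = regular_rep a)"
  then obtain \<rho> where \<rho>: "\<And>a. \<rho> (quot_map E a) = regular_rep a" by blast
  show "is_group_cstar E"
    unfolding is_group_cstar_def
  proof (intro subsetI CollectI)
    fix a assume "a \<in> preannihilator E"
    then have "quot_map E a = quot_map E 0" by (simp add: quot_map_eq_iff[OF E(1)])
    then show "regular_rep a = 0" by (metis \<rho> regular_rep_zero)
  qed
qed

section \<open>The equivalences\<close>

theorem proposition5p1:
  fixes E :: "('g::group_add \<Rightarrow> complex) set"
  assumes "E \<subseteq> fourier_stieltjes"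
    and "linear_subspace E"
    and "closedin weak_star_topology E"
    and "G_invariant E"
  shows "(is_group_cstar E \<longleftrightarrow>
      (\<exists>\<omega>\<in>quot_dual E. \<forall>x::'g. \<omega> (quot_map E (group_elem x)) = (if x = 0 then 1 else 0)))
    \<and> (is_group_cstar E \<longleftrightarrow> canonical_trace \<in> E)
    \<and> (is_group_cstar E \<longleftrightarrow> reduced_fourier_stieltjes \<subseteq> E)
    \<and> (is_group_cstar E \<longleftrightarrow>
      (\<exists>!\<rho>. \<rho> \<in> quot_hom E \<and> (\<forall>a. \<rho> (quot_map E a) = regular_rep a)))"
proof -
  have 1: "reduced_fourier_stieltjes \<subseteq> E" if "is_group_cstar E"
  proof
    fix f :: "'g \<Rightarrow> complex" assume "f \<in> reduced_fourier_stieltjes"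
    then show "f \<in> E"
      using that
      by (intro mem_if_vanishes_on_preannihilator[OF assms(1-3)])
        (auto simp: reduced_fourier_stieltjes_def is_group_cstar_def)
  qed
  have 2: "canonical_trace \<in> E" if "reduced_fourier_stieltjes \<subseteq> E"
    using that canonical_trace_reduced by blast
  have 3: "is_group_cstar E" if "canonical_trace \<in> E"
    by (rule is_group_cstar_if_trace_vanishes[OF assms(1,4)]) (use that in \<open>simp add: preannihilator_def\<close>)
  have 4: "\<exists>\<omega>\<in>quot_dual E. \<forall>x::'g. \<omega> (quot_map E (group_elem x)) = (if x = 0 then 1 else 0)"
    if "canonical_trace \<in> E"
  proof (rule bexI[OF _ quot_dual_descent[OF assms(1) that]], intro allI)
    fix x :: 'g
    have "fs_functional canonical_trace (quot_rep (quot_map E (group_elem x))) = canonical_trace x"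
      by (simp add: functional_descends[OF assms(1) that] fs_functional(2)[OF canonical_trace_fourier_stieltjes(1)])
    then show "fs_functional canonical_trace (quot_rep (quot_map E (group_elem x))) = (if x = 0 then 1 else 0)"
      by (simp add: canonical_trace_def indicator_def)
  qed
  have 5: "is_group_cstar E"
    if "\<exists>\<omega>\<in>quot_dual E. \<forall>x::'g. \<omega> (quot_map E (group_elem x)) = (if x = 0 then 1 else 0)"
    using that is_group_cstar_if_quot_functional[OF assms(1,4)] by blast
  show ?thesis
    using 1 2 3 4 5 regular_rep_factors_iff[OF assms(1,4)] by blast
qed

end
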